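(* Let $k$ be a field, $R=k[t,t^{-1}]$, $K=k(t)$, $n\ge 2$, $G=SL_n(R)$, and let $\Gamma$ be a completely reducible subgroup of $G$. Then $R^n=M_1\oplus\cdots\oplus M_r$ for some $r\geq 1$, where each $M_i$ is a $\Gamma$-invariant $R$-submodule such that $K\otimes_R M_i$ is irreducible in $K^n$ (i.e. is an irreducible $K$-linear representation of $\Gamma$).
   Context: Let $\nu_+$ be the valuation on $K$ giving the order at $0$ and $\nu_-$ the valuation giving the order at infinity, with valuation rings $A_+$ and $A_-$. The twin building of $G=SL_n(R)$ is $X=(X_+,X_-)$, where $X_\pm$ is the Euclidean building of $SL_n(K)$ with respect to $\nu_\pm$: its vertices are the homothety classes of $A_\pm$-lattices in $K^n$ (free $A_\pm$-submodules of rank $n$, up to multiplication by $K^*$), and its simplices are the finite sets of vertices having representatives forming a chain $L_0\supsetneq L_1\supsetneq\cdots\supsetneq L_q\supsetneq\pi_\pm L_0$, where $\pi_\pm$ is a uniformizer of $A_\pm$. $G$ acts on $X_+$ and $X_-$ through its action on $K^n$. For a basis $\{f_1,\dots,f_n\}$ of $K^n$, $[[f_1,\dots,f_n]]$ denotes the class of the $A_+$- (respectively $A_-$-) lattice spanned by $f_1,\dots,f_n$. Each $R$-basis $\{f_1,\dots,f_n\}$ of $R^n$ gives a twin apartment $E=(E_+,E_-)$, where the vertices of $E_\pm$ are the $A_\pm$-lattice classes $[[t^{a_1}f_1,\dots,t^{a_n}f_n]]$ with $a_1,\dots,a_n\in\mathbb Z$; the opposition involution $\mathrm{op}_E$ exchanges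 the $A_+$-lattice class and the $A_-$-lattice class with the same symbol. A simplex of $X_+$ and a simplex of $X_-$ are opposite if they are exchanged by $\mathrm{op}_E$ for some such twin apartment $E$. The fixed point complex of $\Gamma$ is $Y=(Y_+,Y_-)$, where $Y_\epsilon$ consists of the simplices of $X_\epsilon$ fixed by $\Gamma$. The subgroup $\Gamma$ is completely reducible if $Y_+$ and $Y_-$ are nonempty and, for each $\epsilon\in\{+,-\}$, every simplex of $Y_\epsilon$ has an opposite simplex in $Y_{-\epsilon}$. *)

theory Defs
  imports
    "HOL-Analysis.Determinants"
    "HOL-Computational_Algebra.Polynomial"
    "HOL-Computational_Algebra.Fraction_Field"
    "HOL-Algebra.Group"
begin

section \<open>Rational functions, Laurent polynomials and the two valuations\<close>

type_synonym 'k ratfun = "'k poly fract"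

definition tvar :: "'k::field ratfun" where
  "tvar = Fract [:0, 1:] 1"

definition laurent :: "'k::field ratfun set" where
  "laurent = {x. \<exists>p m. x = Fract p 1 * tvar powi m}"

text \<open>\<open>Pos\<close> is the place \<open>t = 0\<close>, \<open>Neg\<close> the place \<open>t = \<infinity>\<close>.\<close>

datatype polarity = Pos | Neg

fun opp :: "polarity \<Rightarrow> polarity" where
  "opp Pos = Neg"
| "opp Neg = Pos"

fun poly_val :: "polarity \<Rightarrow> 'k::field poly \<Rightarrow> int" where
  "poly_val Pos p = int (Polynomial.order 0 p)"
| "poly_val Neg p = - int (degree p)"

text \<open>The value at \<open>0\<close>, which should be \<open>\<infinity>\<close>, is unspecified; \<open>0\<close> is treated separately
  wherever \<open>val\<close> is used.\<close>

definition val :: "polarity \<Rightarrow> 'k::field ratfun \<Rightarrow> int" where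
  "val \<epsilon> x = (THE v. \<exists>p q. p \<noteq> 0 \<and> q \<noteq> 0 \<and> x = Fract p q \<and> v = poly_val \<epsilon> p - poly_val \<epsilon> q)"

definition val_ring :: "polarity \<Rightarrow> 'k::field ratfun set" where
  "val_ring \<epsilon> = {x. x = 0 \<or> 0 \<le> val \<epsilon> x}"

fun uniformizer :: "polarity \<Rightarrow> 'k::field ratfun" where
  "uniformizer Pos = tvar"
| "uniformizer Neg = inverse tvar"

lemma poly_val_mult:
  "p \<noteq> 0 \<Longrightarrow> q \<noteq> 0 \<Longrightarrow> poly_val \<epsilon> (p * q) = poly_val \<epsilon> p + poly_val \<epsilon> q"
  by (cases \<epsilon>) (auto simp: order_mult degree_mult_eq)

lemma val_Fract:
  assumes "p \<noteq> 0" "q \<noteq> 0"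
  shows "val \<epsilon> (Fract p q) = poly_val \<epsilon> p - poly_val \<epsilon> q"
  unfolding val_def
proof (rule the_equality)
  show "\<exists>p' q'. p' \<noteq> 0 \<and> q' \<noteq> 0 \<and> Fract p q = Fract p' q' \<and>
      poly_val \<epsilon> p - poly_val \<epsilon> q = poly_val \<epsilon> p' - poly_val \<epsilon> q'"
    using assms by blast
next
  fix v
  assume "\<exists>p' q'. p' \<noteq> 0 \<and> q' \<noteq> 0 \<and> Fract p q = Fract p' q' \<and> v = poly_val \<epsilon> p' - poly_val \<epsilon> q'"
  then obtain p' q' where *: "p' \<noteq> 0" "q' \<noteq> 0" "Fract p q = Fract p' q'"
    "v = poly_val \<epsilon> p' - poly_val \<epsilon> q'" by blast
  then have "p * q' = p' * q" using assms by (simp add: eq_fract)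
  then have "poly_val \<epsilon> p + poly_val \<epsilon> q' = poly_val \<epsilon> p' + poly_val \<epsilon> q"
    using * assms by (metis poly_val_mult)
  then show "v = poly_val \<epsilon> p - poly_val \<epsilon> q" using * by simp
qed

lemma ratfun_nonzero_cases:
  assumes "x \<noteq> (0 :: 'k::field ratfun)"
  obtains p q where "x = Fract p q" "p \<noteq> 0" "q \<noteq> 0"
  using assms by (metis Fract_cases_nonzero)

lemma val_mult:
  assumes "x \<noteq> 0" "y \<noteq> 0"
  shows "val \<epsilon> (x * y) = val \<epsilon> x + val \<epsilon> y"
proof -
  obtain p q where "x = Fract p q" "p \<noteq> 0" "q \<noteq> 0" using assms ratfun_nonzero_cases by blast
  moreover obtain p' q' where "y = Fract p' q'" "p' \<noteq> 0" "q' \<noteq> 0"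
    using assms ratfun_nonzero_cases by blast
  ultimately show ?thesis by (simp add: val_Fract poly_val_mult)
qed

lemma val_1 [simp]: "val \<epsilon> 1 = 0"
  by (simp add: One_fract_def val_Fract)

lemma tvar_nonzero [simp]: "tvar \<noteq> 0"
  by (simp add: tvar_def Zero_fract_def eq_fract)

lemma val_inverse: "x \<noteq> 0 \<Longrightarrow> val \<epsilon> (inverse x) = - val \<epsilon> x"
  using val_mult[of x "inverse x" \<epsilon>] by simp

lemma val_tvar: "val Pos tvar = 1" "val Neg tvar = -1"
proof -
  have "Polynomial.order 0 [:0, 1 :: 'a:] = 1"
    using order_power_n_n[of "0 :: 'a" 1] by simp
  then show "val Pos (tvar :: 'a ratfun) = 1" "val Neg (tvar :: 'b::field ratfun) = -1"
    unfolding tvar_def by (simp_all add: val_Fract)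
qed

lemma val_uniformizer: "val \<epsilon> (uniformizer \<epsilon>) = 1"
  by (cases \<epsilon>) (simp_all add: val_tvar val_inverse)

lemma val_power: "x \<noteq> 0 \<Longrightarrow> val \<epsilon> (x ^ m) = int m * val \<epsilon> x"
  by (induction m) (simp_all add: val_mult algebra_simps)

lemma val_power_int: "x \<noteq> 0 \<Longrightarrow> val \<epsilon> (x powi m) = m * val \<epsilon> x"
  by (simp add: power_int_def val_power val_inverse)

lemma laurent_Fract [simp]: "Fract p 1 \<in> laurent"
proof -
  have "Fract p 1 = Fract p 1 * tvar powi 0" by simp
  then show ?thesis unfolding laurent_def by blast
qed

lemma laurent_0 [simp]: "0 \<in> laurent" and laurent_1 [simp]: "1 \<in> laurent"
  by (simp_all only: Zero_fract_def One_fract_def laurent_Fract)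

lemma laurent_mult: "x \<in> laurent \<Longrightarrow> y \<in> laurent \<Longrightarrow> x * y \<in> laurent"
proof -
  assume "x \<in> laurent" "y \<in> laurent"
  then obtain p m q l where "x = Fract p 1 * tvar powi m" "y = Fract q 1 * tvar powi l"
    unfolding laurent_def by blast
  then have "x * y = Fract (p * q) 1 * tvar powi (m + l)"
    by (simp add: power_int_add mult_ac flip: mult_fract[of _ 1 _ 1, simplified])
  then show ?thesis unfolding laurent_def by blast
qed

lemma laurent_minus: "x \<in> laurent \<Longrightarrow> - x \<in> laurent"
proof -
  have "Fract (-1) 1 = (-1 :: 'a ratfun)" by (simp only: minus_fract[symmetric] One_fract_def)
  then show "x \<in> laurent \<Longrightarrow> - x \<in> laurent"
    using laurent_mult[OF laurent_Fract[of "-1"]] by fastforce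
qed

lemma tvar_power: "tvar ^ m = Fract (monom 1 m) 1"
  by (induction m) (simp_all add: tvar_def One_fract_def monom_0 monom_Suc one_pCons)

lemma laurent_add: "x \<in> laurent \<Longrightarrow> y \<in> laurent \<Longrightarrow> x + y \<in> laurent"
proof -
  assume "x \<in> laurent" "y \<in> laurent"
  then obtain p m q l where xy: "x = Fract p 1 * tvar powi m" "y = Fract q 1 * tvar powi l"
    unfolding laurent_def by blast
  define j where "j = min m l"
  have "tvar powi m = tvar powi j * tvar ^ nat (m - j)"
       "tvar powi l = (tvar :: 'a ratfun) powi j * tvar ^ nat (l - j)"
    by (simp_all add: j_def flip: power_int_add power_int_of_nat)
  note ml = this[unfolded tvar_power]
  then have "x + y = (Fract p 1 * Fract (monom 1 (nat (m - j))) 1 +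
      Fract q 1 * Fract (monom 1 (nat (l - j))) 1) * tvar powi j"
    unfolding xy by (simp only: ml) (simp only: algebra_simps)
  also have "\<dots> = Fract (p * monom 1 (nat (m - j)) + q * monom 1 (nat (l - j))) 1 * tvar powi j"
    by simp
  finally show ?thesis unfolding laurent_def by blast
qed

lemma laurent_sum: "(\<And>i. i \<in> I \<Longrightarrow> f i \<in> laurent) \<Longrightarrow> sum f I \<in> laurent"
  by (induction I rule: infinite_finite_induct) (auto intro: laurent_add)

lemma laurent_prod: "(\<And>i. i \<in> I \<Longrightarrow> f i \<in> laurent) \<Longrightarrow> prod f I \<in> laurent"
  by (induction I rule: infinite_finite_induct) (auto intro: laurent_mult)


section \<open>Free modules in \<open>K\<^sup>n\<close> and the group \<open>SL\<^sub>n(R)\<close>\<close>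

definition lincombs :: "'a::field set \<Rightarrow> ('n \<Rightarrow> 'a ^ 'n) \<Rightarrow> ('a ^ 'n) set" where
  "lincombs S f = {\<Sum>i\<in>UNIV. c i *s f i | c. \<forall>i. c i \<in> S}"

definition free_basis :: "'a::field set \<Rightarrow> ('n \<Rightarrow> 'a ^ 'n) \<Rightarrow> ('a ^ 'n) set \<Rightarrow> bool" where
  "free_basis S f L \<longleftrightarrow> L = lincombs S f \<and>
     (\<forall>c. (\<forall>i. c i \<in> S) \<and> (\<Sum>i\<in>UNIV. c i *s f i) = 0 \<longrightarrow> (\<forall>i. c i = 0))"

definition laurent_vecs :: "('k::field ratfun ^ 'n) set" where
  "laurent_vecs = {v. \<forall>i. v $ i \<in> laurent}"

definition SL_laurent :: "('k::field ratfun ^ 'n ^ 'n) monoid" where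
  "SL_laurent = \<lparr>carrier = {g. (\<forall>i j. g $ i $ j \<in> laurent) \<and> det g = 1},
     monoid.mult = (**), one = mat 1\<rparr>"

lemma laurent_det:
  fixes g :: "'k::field ratfun ^ 'n ^ 'n"
  assumes *: "\<And>i j. g $ i $ j \<in> laurent"
  shows "det g \<in> laurent"
proof -
  have "of_int (sign p) \<in> (laurent :: 'k ratfun set)" for p :: "'n \<Rightarrow> 'n"
    by (cases p rule: sign_cases) (auto intro: laurent_minus)
  then show ?thesis unfolding det_def
    by (intro laurent_sum laurent_mult laurent_prod *)
qed

lemma group_SL_laurent: "group (SL_laurent :: ('k::field ratfun ^ 'n ^ 'n) monoid)"
proof (rule groupI)
  fix x y :: "'k ratfun ^ 'n ^ 'n"
  assume "x \<in> carrier SL_laurent" "y \<in> carrier SL_laurent"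
  moreover from this have "(x ** y) $ i $ j \<in> laurent" for i j
    by (auto simp: SL_laurent_def matrix_matrix_mult_def intro!: laurent_sum laurent_mult)
  ultimately show "x \<otimes>\<^bsub>SL_laurent\<^esub> y \<in> carrier SL_laurent"
    by (simp add: SL_laurent_def det_mul)
next
  show "\<one>\<^bsub>SL_laurent\<^esub> \<in> carrier (SL_laurent :: ('k ratfun ^ 'n ^ 'n) monoid)"
    by (simp add: SL_laurent_def det_I) (simp add: mat_def)
next
  fix x :: "'k ratfun ^ 'n ^ 'n"
  assume "x \<in> carrier SL_laurent"
  then have x: "\<And>i j. x $ i $ j \<in> laurent" "det x = 1" by (auto simp: SL_laurent_def)
  define y :: "'k ratfun ^ 'n ^ 'n" where
    "y = (\<chi> k l. det (\<chi> i j. if j = k then axis l 1 $ i else x $ i $ j))"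
  have "x *v column l y = axis l 1" for l
    using cramer[of x "column l y" "axis l 1"] x by (simp add: y_def column_def)
  then have xy: "x ** y = mat 1"
    by (simp add: vec_eq_iff matrix_matrix_mult_def matrix_vector_mult_def column_def mat_def axis_def)
  then have "det y = 1" using x det_mul[of x y] by simp
  moreover have "y $ k $ l \<in> laurent" for k l
    unfolding y_def by (auto intro!: laurent_det x simp: axis_def)
  ultimately have "y \<in> carrier SL_laurent" by (simp add: SL_laurent_def)
  moreover have "y ** x = mat 1" using xy by (simp add: matrix_left_right_inverse)
  ultimately show "\<exists>y\<in>carrier SL_laurent. y \<otimes>\<^bsub>SL_laurent\<^esub> x = \<one>\<^bsub>SL_laurent\<^esub>"
    by (auto simp: SL_laurent_def)
qed (auto simp: SL_laurent_def matrix_mul_assoc)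


section \<open>The twin building\<close>

definition is_lattice :: "polarity \<Rightarrow> ('k::field ratfun ^ 'n) set \<Rightarrow> bool" where
  "is_lattice \<epsilon> L \<longleftrightarrow> (\<exists>f. free_basis (val_ring \<epsilon>) f L)"

definition hclass :: "('a::field ^ 'n) set \<Rightarrow> ('a ^ 'n) set set" where
  "hclass L = {(*s) c ` L | c. c \<noteq> 0}"

definition simplices :: "polarity \<Rightarrow> ('k::field ratfun ^ 'n) set set set set" where
  "simplices \<epsilon> = {\<sigma>. \<exists>(q::nat) L. (\<forall>i\<le>q. is_lattice \<epsilon> (L i)) \<and> (\<forall>i<q. L (Suc i) \<subset> L i) \<and>
     (*s) (uniformizer \<epsilon>) ` L 0 \<subset> L q \<and> \<sigma> = (\<lambda>i. hclass (L i)) ` {..q}}"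

text \<open>\<open>act_simplex g\<close> is the action of a matrix on vectors, transported to lattices, to homothety
  classes of lattices, and to sets of such classes.\<close>

definition act_simplex ::
    "'a::field ^ 'n ^ 'n \<Rightarrow> ('a ^ 'n) set set set \<Rightarrow> ('a ^ 'n) set set set" where
  "act_simplex g \<sigma> = image (image (image ((*v) g))) \<sigma>"

definition apt_vertex ::
    "polarity \<Rightarrow> ('n \<Rightarrow> 'k::field ratfun ^ 'n) \<Rightarrow> ('n \<Rightarrow> int) \<Rightarrow> ('k ratfun ^ 'n) set set" where
  "apt_vertex \<epsilon> f a = hclass (lincombs (val_ring \<epsilon>) (\<lambda>i. tvar powi a i *s f i))"

definition apartment ::
    "('n \<Rightarrow> 'k::field ratfun ^ 'n) \<Rightarrow> polarity \<Rightarrow> ('k ratfun ^ 'n) set set set" where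
  "apartment f \<epsilon> = range (apt_vertex \<epsilon> f)"

text \<open>\<open>op_apt f \<epsilon>\<close> is the opposition involution of the twin apartment of \<open>f\<close>, on the vertices
  of its \<open>\<epsilon>\<close>-half. It is well defined when \<open>f\<close> is an \<open>R\<close>-basis of \<open>R\<^sup>n\<close>: see
  \<open>op_apt_apt_vertex\<close> below.\<close>

definition op_apt ::
    "('n \<Rightarrow> 'k::field ratfun ^ 'n) \<Rightarrow> polarity \<Rightarrow> ('k ratfun ^ 'n) set set \<Rightarrow> ('k ratfun ^ 'n) set set" where
  "op_apt f \<epsilon> v = (THE w. \<exists>a. v = apt_vertex \<epsilon> f a \<and> w = apt_vertex (opp \<epsilon>) f a)"

definition opposite ::
    "polarity \<Rightarrow> ('k::field ratfun ^ 'n) set set set \<Rightarrow> ('k ratfun ^ 'n) set set set \<Rightarrow> bool" where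
  "opposite \<epsilon> \<sigma> \<tau> \<longleftrightarrow> \<sigma> \<in> simplices \<epsilon> \<and> \<tau> \<in> simplices (opp \<epsilon>) \<and>
     (\<exists>f. free_basis laurent f laurent_vecs \<and>
        \<sigma> \<subseteq> apartment f \<epsilon> \<and> \<tau> \<subseteq> apartment f (opp \<epsilon>) \<and>
        op_apt f \<epsilon> ` \<sigma> = \<tau> \<and> op_apt f (opp \<epsilon>) ` \<tau> = \<sigma>)"

definition fixed_simplices ::
    "('k::field ratfun ^ 'n ^ 'n) set \<Rightarrow> polarity \<Rightarrow> ('k ratfun ^ 'n) set set set set" where
  "fixed_simplices \<Gamma> \<epsilon> = {\<sigma> \<in> simplices \<epsilon>. \<forall>g\<in>\<Gamma>. act_simplex g \<sigma> = \<sigma>}"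

definition completely_reducible :: "('k::field ratfun ^ 'n ^ 'n) set \<Rightarrow> bool" where
  "completely_reducible \<Gamma> \<longleftrightarrow>
     fixed_simplices \<Gamma> Pos \<noteq> {} \<and> fixed_simplices \<Gamma> Neg \<noteq> {} \<and>
     (\<forall>\<epsilon>. \<forall>\<sigma>\<in>fixed_simplices \<Gamma> \<epsilon>. \<exists>\<tau>\<in>fixed_simplices \<Gamma> (opp \<epsilon>). opposite \<epsilon> \<sigma> \<tau>)"

lemma laurent_basis_indep:
  fixes f :: "'n::finite \<Rightarrow> 'k::field ratfun ^ 'n"
  assumes f: "free_basis laurent f L" and eq: "(\<Sum>i\<in>UNIV. c i *s f i) = 0"
  shows "c i = 0"
proof -
  have "\<exists>p q. q \<noteq> 0 \<and> c i = Fract p q" for i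
    by (cases "c i" rule: Fract_cases) auto
  then obtain p q where pq: "\<And>i. q i \<noteq> 0" "\<And>i. c i = Fract (p i) (q i)" by metis
  define d where "d = (\<Prod>i\<in>UNIV. Fract (q i) 1)"
  have q0: "Fract (q i) 1 \<noteq> 0" for i using pq by (simp add: Zero_fract_def eq_fract)
  have d0: "d \<noteq> 0" unfolding d_def using q0 by simp
  have dc: "d * c i \<in> laurent" for i
  proof -
    have 1: "d = Fract (q i) 1 * (\<Prod>i\<in>UNIV - {i}. Fract (q i) 1)"
      unfolding d_def by (subst prod.remove[of _ i]) auto
    have 2: "Fract (q i) 1 * c i = Fract (p i) 1"
      using pq(1)[of i] by (simp add: pq(2) eq_fract)
    have "d * c i = Fract (q i) 1 * c i * (\<Prod>i\<in>UNIV - {i}. Fract (q i) 1)"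
      unfolding 1 by (simp only: mult_ac)
    then have "d * c i = Fract (p i) 1 * (\<Prod>i\<in>UNIV - {i}. Fract (q i) 1)"
      by (simp only: 2)
    then show ?thesis by (auto intro!: laurent_mult laurent_prod)
  qed
  have "(\<Sum>i\<in>UNIV. (d * c i) *s f i) = d *s (\<Sum>i\<in>UNIV. c i *s f i)"
    by (simp add: vec.scale_sum_right)
  then have "(\<Sum>i\<in>UNIV. (d * c i) *s f i) = 0" by (simp only: eq vec.scale_zero_right)
  then have "\<forall>i. d * c i = 0"
    using f[unfolded free_basis_def, THEN conjunct2, rule_format, of "\<lambda>i. d * c i"] dc by blast
  then show ?thesis using d0 by simp
qed

lemma laurent_basis_coeff_eq:
  fixes f :: "'n::finite \<Rightarrow> 'k::field ratfun ^ 'n"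
  assumes f: "free_basis laurent f L"
    and eq: "(\<Sum>i\<in>UNIV. c i *s f i) = (\<Sum>i\<in>UNIV. d i *s f i)"
  shows "c i = d i"
  using laurent_basis_indep[OF f, of "\<lambda>i. c i - d i" i] eq
  by (simp add: sum_subtractf vec.scale_left_diff_distrib)

lemma hclass_self: "L \<in> hclass L"
  unfolding hclass_def by (auto intro!: exI[of _ 1])

lemma hclass_scale:
  assumes c: "c \<noteq> 0"
  shows "hclass ((*s) c ` L) = hclass L"
proof -
  have 1: "(*s) d ` (*s) c ` L = (*s) (d * c) ` L" for d
    by (simp add: image_image)
  show ?thesis
  proof (intro equalityI subsetI)
    fix M assume "M \<in> hclass ((*s) c ` L)"
    then obtain d where "d \<noteq> 0" "M = (*s) (d * c) ` L" unfolding hclass_def 1 by blast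
    with c show "M \<in> hclass L" unfolding hclass_def by (intro CollectI exI[of _ "d * c"]) simp
  next
    fix M assume "M \<in> hclass L"
    then obtain d where "d \<noteq> 0" "M = (*s) d ` L" unfolding hclass_def by blast
    with c show "M \<in> hclass ((*s) c ` L)" unfolding hclass_def 1
      by (intro CollectI exI[of _ "d / c"]) simp
  qed
qed

lemma lincombs_scale:
  "(*s) c ` lincombs S f = lincombs S (\<lambda>i. c *s f i)"
proof -
  have "c *s (\<Sum>i\<in>UNIV. d i *s f i) = (\<Sum>i\<in>UNIV. d i *s (c *s f i))" for d
    by (simp add: vec.scale_sum_right mult.commute)
  then show ?thesis unfolding lincombs_def setcompr_eq_image image_image by simp
qed

lemma apt_vertex_shift: "apt_vertex \<epsilon> f (\<lambda>i. a i + m) = apt_vertex \<epsilon> f a"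
proof -
  have "lincombs (val_ring \<epsilon>) (\<lambda>i. tvar powi (a i + m) *s f i) =
      (*s) (tvar powi m) ` lincombs (val_ring \<epsilon>) (\<lambda>i. tvar powi a i *s f i)"
    by (simp add: lincombs_scale power_int_add mult.commute)
  then show ?thesis unfolding apt_vertex_def by (simp add: hclass_scale)
qed

lemma lincombs_coeffs:
  fixes f :: "'n::finite \<Rightarrow> 'k::field ratfun ^ 'n"
  assumes f: "free_basis laurent f M"
    and mem: "x *s f i \<in> lincombs (val_ring \<epsilon>) (\<lambda>j. y j *s f j)"
    and nz: "x \<noteq> 0" "y i \<noteq> 0"
  shows "val \<epsilon> x \<ge> val \<epsilon> (y i)"
proof -
  obtain d where d: "\<And>j. d j \<in> val_ring \<epsilon>" and eq: "x *s f i = (\<Sum>j\<in>UNIV. d j *s (y j *s f j))"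
    using mem unfolding lincombs_def by blast
  have "x *s f i = (\<Sum>j\<in>UNIV. (if j = i then x else 0) *s f j)"
    by (subst sum.remove[of _ i]) (auto intro: sum.neutral)
  with eq have "(\<Sum>j\<in>UNIV. (if j = i then x else 0) *s f j) = (\<Sum>j\<in>UNIV. (d j * y j) *s f j)"
    by simp
  from laurent_basis_coeff_eq[OF f this, of i] have x: "x = d i * y i" by simp
  then have "d i \<noteq> 0" using nz by auto
  then have "val \<epsilon> x = val \<epsilon> (d i) + val \<epsilon> (y i)" "val \<epsilon> (d i) \<ge> 0"
    using x nz d[of i] by (auto simp: val_mult val_ring_def)
  then show ?thesis by simp
qed

lemma lincombs_base: "f i \<in> lincombs (val_ring \<epsilon>) f"
proof -
  have "f i = (\<Sum>j\<in>UNIV. (if j = i then 1 else 0) *s f j)"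
    by (subst sum.remove[of _ i]) (auto intro: sum.neutral)
  then show ?thesis unfolding lincombs_def
    by (auto simp: val_ring_def intro!: exI[of _ "\<lambda>j. if j = i then 1 else 0"])
qed

lemma apt_vertex_eqD:
  fixes f :: "'n::finite \<Rightarrow> 'k::field ratfun ^ 'n"
  assumes f: "free_basis laurent f M" and eq: "apt_vertex \<epsilon> f a = apt_vertex \<epsilon> f b"
  shows "\<exists>m. b = (\<lambda>i. a i + m)"
proof -
  let ?L = "\<lambda>a. lincombs (val_ring \<epsilon>) (\<lambda>i. tvar powi a i *s f i)"
  have "?L b \<in> hclass (?L a)"
    using eq hclass_self unfolding apt_vertex_def by blast
  then obtain c where c: "c \<noteq> 0" "?L b = (*s) c ` ?L a" unfolding hclass_def by blast
  then have Lb: "?L b = lincombs (val_ring \<epsilon>) (\<lambda>i. (c * tvar powi a i) *s f i)"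
    by (simp add: lincombs_scale)
  have "b i * val \<epsilon> (tvar :: 'k ratfun) = val \<epsilon> c + a i * val \<epsilon> (tvar :: 'k ratfun)" for i
  proof (rule antisym)
    have "tvar powi b i *s f i \<in> lincombs (val_ring \<epsilon>) (\<lambda>i. (c * tvar powi a i) *s f i)"
      unfolding Lb[symmetric] by (rule lincombs_base)
    from lincombs_coeffs[OF f this] c
    show "val \<epsilon> c + a i * val \<epsilon> (tvar :: 'k ratfun) \<le> b i * val \<epsilon> (tvar :: 'k ratfun)"
      by (simp add: val_mult val_power_int)
    have "(c * tvar powi a i) *s f i \<in> ?L b"
      unfolding Lb by (rule lincombs_base)
    from lincombs_coeffs[OF f this] c
    show "b i * val \<epsilon> (tvar :: 'k ratfun) \<le> val \<epsilon> c + a i * val \<epsilon> (tvar :: 'k ratfun)"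
      by (simp add: val_mult val_power_int)
  qed
  then have "b i = a i + val \<epsilon> c * val \<epsilon> (tvar :: 'k ratfun)" for i
    by (cases \<epsilon>) (simp_all add: val_tvar, smt (verit))
  then show ?thesis by blast
qed

lemma op_apt_apt_vertex:
  fixes f :: "'n::finite \<Rightarrow> 'k::field ratfun ^ 'n"
  assumes "free_basis laurent f laurent_vecs"
  shows "op_apt f \<epsilon> (apt_vertex \<epsilon> f a) = apt_vertex (opp \<epsilon>) f a"
  unfolding op_apt_def
proof (rule the_equality)
  fix w
  assume "\<exists>b. apt_vertex \<epsilon> f a = apt_vertex \<epsilon> f b \<and> w = apt_vertex (opp \<epsilon>) f b"
  then show "w = apt_vertex (opp \<epsilon>) f a"
    using apt_vertex_eqD[OF assms] apt_vertex_shift by metis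
qed blast


section \<open>Representations and direct sums\<close>

definition laurent_submodule :: "('k::field ratfun ^ 'n) set \<Rightarrow> bool" where
  "laurent_submodule M \<longleftrightarrow> M \<subseteq> laurent_vecs \<and> 0 \<in> M \<and>
     (\<forall>v\<in>M. \<forall>w\<in>M. v + w \<in> M) \<and> (\<forall>c\<in>laurent. \<forall>v\<in>M. c *s v \<in> M)"

definition invariant :: "('a::field ^ 'n ^ 'n) set \<Rightarrow> ('a ^ 'n) set \<Rightarrow> bool" where
  "invariant \<Gamma> M \<longleftrightarrow> (\<forall>g\<in>\<Gamma>. \<forall>v\<in>M. g *v v \<in> M)"

definition irreducible_rep :: "('a::field ^ 'n ^ 'n) set \<Rightarrow> ('a ^ 'n) set \<Rightarrow> bool" where
  "irreducible_rep \<Gamma> W \<longleftrightarrow> vec.subspace W \<and> invariant \<Gamma> W \<and> W \<noteq> {0} \<and>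
     (\<forall>U. vec.subspace U \<and> U \<subseteq> W \<and> invariant \<Gamma> U \<longrightarrow> U = {0} \<or> U = W)"

text \<open>For an \<open>R\<close>-submodule \<open>M\<close> of \<open>K\<^sup>n\<close>, the canonical map from \<open>K \<otimes>\<^sub>R M\<close> to \<open>K\<^sup>n\<close> is injective
  because \<open>K\<close> is flat over \<open>R\<close>; \<open>K \<otimes>\<^sub>R M\<close> is identified with its image.\<close>

definition extend_scalars :: "('k::field ratfun ^ 'n) set \<Rightarrow> ('k ratfun ^ 'n) set" where
  "extend_scalars M = vec.span M"

definition direct_sum_decomp :: "'i set \<Rightarrow> ('i \<Rightarrow> 'v::ab_group_add set) \<Rightarrow> 'v set \<Rightarrow> bool" where
  "direct_sum_decomp I M V \<longleftrightarrow> V = {\<Sum>i\<in>I. m i | m. \<forall>i\<in>I. m i \<in> M i} \<and>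
     (\<forall>m. (\<forall>i\<in>I. m i \<in> M i) \<and> (\<Sum>i\<in>I. m i) = 0 \<longrightarrow> (\<forall>i\<in>I. m i = 0))"

end

theory Submission
  imports Defs
begin

text \<open>
  By hypothesis \<open>\<Gamma>\<close> fixes a simplex of \<open>X\<^sub>+\<close>. Since the elements of \<open>\<Gamma>\<close> have
  determinant one they preserve types, so \<open>\<Gamma>\<close> stabilizes every lattice that represents a vertex
  of a fixed simplex (\<open>fixed_simplex_stabilizes_lattices\<close>), and not only its class. An opposite
  fixed simplex then provides an \<open>R\<close>-basis of \<open>R\<^sup>n\<close>, the columns of a matrix \<open>P\<close>, such that \<open>\<Gamma>\<close>
  stabilizes both the \<open>A\<^sub>+\<close>-lattice and the \<open>A\<^sub>-\<close>-lattice spanned by it. In this basis the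
  elements of \<open>\<Gamma>\<close> have entries in \<open>R \<inter> A\<^sub>+ \<inter> A\<^sub>- = k\<close> (\<open>frame_action_const\<close>), so the
  representation of \<open>\<Gamma>\<close> on \<open>R\<^sup>n\<close> is extended from a representation on \<open>k\<^sup>n\<close>.

  This representation over \<open>k\<close> is semisimple (\<open>invariant_subspace_projection\<close>). A proper nonzero
  invariant subspace \<open>U\<close> of \<open>k\<^sup>n = L/tL\<close>, where \<open>L = P A\<^sub>+\<^sup>n\<close>, is the same thing as a fixed edge
  \<open>{[L], [L']}\<close> with \<open>tL \<subset> L' \<subset> L\<close>. A fixed edge opposite to it gives a second basis, adapted to
  \<open>L\<close> and \<open>L'\<close> at once, in which \<open>\<Gamma>\<close> again acts by constant matrices, and the two lattices at
  infinity force these matrices to be block diagonal. The second block, reduced modulo \<open>t\<close>, is an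
  invariant complement of \<open>U\<close>.

  Complete reducibility over \<open>k\<close> yields orthogonal idempotent matrices over \<open>k\<close>, commuting with
  the action, with sum 1 and irreducible images (\<open>irreducible_idempotents\<close>). Having constant
  entries, they decompose \<open>R\<^sup>n\<close> itself. Each summand stays irreducible over \<open>K = k(t)\<close>
  (\<open>irreducible_after_scalar_extension\<close>): a \<open>K\<close>-subspace of \<open>K\<^sup>n\<close> meets \<open>A\<^sub>+\<^sup>n\<close> in a module whose
  reduction modulo \<open>t\<close> is a \<open>k\<close>-subspace of the same dimension, so a proper invariant subspace
  over \<open>K\<close> would give one over \<open>k\<close>.
\<close>

section \<open>Vectors and matrices over a subring of a field\<close>

definition is_subring :: "'a::field set \<Rightarrow> bool" where
  "is_subring S \<longleftrightarrow> 1 \<in> S \<and> (\<forall>x\<in>S. \<forall>y\<in>S. x - y \<in> S \<and> x * y \<in> S)"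

definition vecs :: "'a set \<Rightarrow> ('a ^ 'n) set" where
  "vecs S = {v. \<forall>i. v $ i \<in> S}"

definition mats :: "'a set \<Rightarrow> ('a ^ 'n ^ 'm) set" where
  "mats S = {B. \<forall>i j. B $ i $ j \<in> S}"

lemma subring_closed:
  assumes "is_subring S"
  shows "1 \<in> S" "0 \<in> S" "x \<in> S \<Longrightarrow> - x \<in> S" "x \<in> S \<Longrightarrow> y \<in> S \<Longrightarrow> x + y \<in> S"
    "x \<in> S \<Longrightarrow> y \<in> S \<Longrightarrow> x - y \<in> S" "x \<in> S \<Longrightarrow> y \<in> S \<Longrightarrow> x * y \<in> S"
proof -
  have S: "1 \<in> S" "\<And>x y. x \<in> S \<Longrightarrow> y \<in> S \<Longrightarrow> x - y \<in> S" "\<And>x y. x \<in> S \<Longrightarrow> y \<in> S \<Longrightarrow> x * y \<in> S"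
    using assms by (auto simp: is_subring_def)
  show "1 \<in> S" by (rule S)
  show 0: "0 \<in> S" using S(2)[OF S(1) S(1)] by simp
  show minus: "- x \<in> S" if "x \<in> S" for x using S(2)[OF 0 that] by simp
  show "x + y \<in> S" if "x \<in> S" "y \<in> S" using S(2)[OF that(1) minus[OF that(2)]] by simp
  show "x - y \<in> S" "x * y \<in> S" if "x \<in> S" "y \<in> S" using S that by auto
qed

lemma subring_sum: "is_subring S \<Longrightarrow> (\<And>i. i \<in> I \<Longrightarrow> f i \<in> S) \<Longrightarrow> sum f I \<in> S"
  by (induction I rule: infinite_finite_induct) (auto intro: subring_closed)

lemma subring_prod: "is_subring S \<Longrightarrow> (\<And>i. i \<in> I \<Longrightarrow> f i \<in> S) \<Longrightarrow> prod f I \<in> S"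
  by (induction I rule: infinite_finite_induct) (auto intro: subring_closed)

lemma axis_in_vecs: "is_subring S \<Longrightarrow> axis i 1 \<in> vecs S"
  by (auto simp: vecs_def axis_def intro: subring_closed)

lemma matrix_vector_in_vecs:
  "is_subring S \<Longrightarrow> B \<in> mats S \<Longrightarrow> y \<in> vecs S \<Longrightarrow> B *v y \<in> vecs S"
  by (auto simp: vecs_def mats_def matrix_vector_mult_def intro!: subring_sum subring_closed)

lemma matrix_vector_axis: "((B :: 'a::field ^ 'n ^ 'm) *v axis j 1) $ i = B $ i $ j"
  by (simp add: matrix_vector_mult_def axis_def if_distrib cong: if_cong)

lemma matrix_in_mats:
  fixes B :: "'a::field ^ 'n ^ 'm"
  assumes "is_subring S" "(*v) B ` vecs S \<subseteq> vecs S"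
  shows "B \<in> mats S"
proof -
  have "B *v axis j 1 \<in> vecs S" for j using assms axis_in_vecs by blast
  then show ?thesis by (auto simp: vecs_def mats_def matrix_vector_axis)
qed

lemma det_in_subring:
  fixes B :: "'a::field ^ 'n ^ 'n"
  assumes S: "is_subring S" and B: "B \<in> mats S"
  shows "det B \<in> S"
proof -
  have "of_int (sign p) \<in> S" for p :: "'n \<Rightarrow> 'n"
    by (cases p rule: sign_cases) (auto intro: subring_closed[OF S])
  with B show ?thesis unfolding det_def
    by (auto intro!: subring_sum subring_prod subring_closed S simp: mats_def)
qed

text \<open>Cramer's rule writes the solution of \<open>B x = b\<close> as determinants over \<open>S\<close> divided by \<open>det B\<close>,
  so no denominators appear when \<open>det B\<close> is a unit of \<open>S\<close>.\<close>

lemma vecs_image_eq_if_unit_det: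
  fixes B :: "'a::field ^ 'n ^ 'n"
  assumes S: "is_subring S" and B: "B \<in> mats S" and d: "det B \<noteq> 0" "inverse (det B) \<in> S"
  shows "(*v) B ` vecs S = vecs S"
proof
  show "(*v) B ` vecs S \<subseteq> vecs S" using matrix_vector_in_vecs[OF S B] by blast
  show "vecs S \<subseteq> (*v) B ` vecs S"
  proof
    fix b :: "'a ^ 'n" assume b: "b \<in> vecs S"
    define x where "x = (\<chi> k. det (\<chi> i j. if j = k then b $ i else B $ i $ j) / det B)"
    have "B *v x = b" using cramer[OF d(1)] x_def by blast
    moreover have "x \<in> vecs S"
      using b B d(2)
      by (auto simp: x_def vecs_def divide_inverse mats_def
          intro!: subring_closed(6)[OF S] det_in_subring[OF S])
    ultimately show "b \<in> (*v) B ` vecs S" by blast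
  qed
qed

lemma invertible_obtain:
  fixes B :: "'a::field ^ 'n ^ 'n"
  assumes "invertible B"
  obtains C where "C ** B = mat 1" "B ** C = mat 1" "invertible C"
proof -
  obtain C where "C ** B = mat 1" "B ** C = mat 1" using assms unfolding invertible_def by blast
  then show ?thesis using that unfolding invertible_def by blast
qed

lemma matrix_cancel:
  fixes B :: "'a::field ^ 'n ^ 'n"
  assumes "C ** B = mat 1"
  shows "C *v (B *v x) = x" "C ** (B ** X) = X"
  using assms by (simp_all add: matrix_vector_mul_assoc matrix_mul_assoc)

lemma matrix_scalar_mult: "B *v (c *s x) = c *s ((B :: 'a::field ^ 'n ^ 'm) *v x)"
  by (rule vec.scale)

section \<open>The valuation rings and the residue field at 0\<close>

lemma poly_val_add:
  assumes "p \<noteq> 0" "q \<noteq> 0" "p + q \<noteq> 0"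
  shows "min (poly_val \<epsilon> p) (poly_val \<epsilon> q) \<le> poly_val \<epsilon> (p + q)"
proof (cases \<epsilon>)
  case Pos
  let ?m = "min (order 0 p) (order 0 q)"
  have "[:-0, 1:] ^ ?m dvd p" "[:-0, 1:] ^ ?m dvd q"
    using assms by (simp_all only: order_divides) simp_all
  then have "[:-0, 1:] ^ ?m dvd p + q" by (rule dvd_add)
  then have "?m \<le> order 0 (p + q)" using assms by (simp only: order_divides) simp
  then show ?thesis using Pos by (simp add: min_def split: if_splits)
next
  case Neg
  have "degree (p + q) \<le> max (degree p) (degree q)" by (rule degree_add_le_max)
  then show ?thesis using Neg by (simp add: min_def max_def split: if_splits)
qed

lemma val_add:
  assumes "x \<noteq> 0" "y \<noteq> 0" "x + y \<noteq> 0"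
  shows "min (val \<epsilon> x) (val \<epsilon> y) \<le> val \<epsilon> (x + y)"
proof -
  obtain p q where x: "x = Fract p q" "p \<noteq> 0" "q \<noteq> 0" using assms ratfun_nonzero_cases by blast
  obtain p' q' where y: "y = Fract p' q'" "p' \<noteq> 0" "q' \<noteq> 0" using assms ratfun_nonzero_cases by blast
  have xy: "x + y = Fract (p * q' + p' * q) (q * q')" using x y by simp
  then have nz: "p * q' + p' * q \<noteq> 0" using assms(3) by (auto simp: fract_collapse)
  then show ?thesis
    using poly_val_add[of "p * q'" "p' * q" \<epsilon>] x y unfolding xy
    by (simp add: val_Fract poly_val_mult)
qed

lemma val_minus: "val \<epsilon> (- x) = val \<epsilon> x"
proof (cases "x = 0")
  case False
  then obtain p q where x: "x = Fract p q" "p \<noteq> 0" "q \<noteq> 0" using ratfun_nonzero_cases by blast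
  moreover have "poly_val \<epsilon> (- p) = poly_val \<epsilon> p"
    by (cases \<epsilon>) (simp_all add: order_uminus)
  ultimately show ?thesis by (simp add: val_Fract)
qed simp

lemma is_subring_val_ring: "is_subring (val_ring \<epsilon>)"
proof -
  have "x - y \<in> val_ring \<epsilon>" if "x \<in> val_ring \<epsilon>" "y \<in> val_ring \<epsilon>" for x y :: "'a ratfun"
    using val_add[of x "- y" \<epsilon>] that unfolding val_ring_def
    by (cases "x = 0"; cases "y = 0"; cases "x = y") (simp_all add: val_minus)
  then show ?thesis unfolding is_subring_def
    by (simp add: val_ring_def) (metis add_nonneg_nonneg val_mult)
qed

lemma is_subring_laurent: "is_subring laurent"
proof -
  have "x - y \<in> laurent" if "x \<in> laurent" "y \<in> laurent" for x y :: "'a ratfun"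
    using laurent_add[OF that(1) laurent_minus[OF that(2)]] by simp
  then show ?thesis by (simp add: is_subring_def laurent_mult)
qed

definition const :: "'k::field \<Rightarrow> 'k ratfun" where
  "const c = Fract [:c:] 1"

lemma const_simps [simp]:
  "const 0 = 0" "const 1 = 1" "const (a + b) = const a + const b"
  "const (a - b) = const a - const b" "const (a * b) = const a * const b"
  by (simp_all add: const_def fract_collapse One_fract_def one_pCons mult.commute)

lemma const_eq_0 [simp]: "const c = 0 \<longleftrightarrow> c = 0"
  by (simp add: const_def Zero_fract_def eq_fract)

lemma const_sum: "const (sum f I) = (\<Sum>i\<in>I. const (f i))"
  by (induction I rule: infinite_finite_induct) simp_all

lemma val_const: "c \<noteq> 0 \<Longrightarrow> val \<epsilon> (const c) = 0"
  unfolding const_def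
  by (cases \<epsilon>) (simp_all add: val_Fract order_0I)

lemma const_in_val_ring: "const c \<in> val_ring \<epsilon>"
  by (cases "c = 0") (auto simp: val_ring_def val_const)

text \<open>The possible poles of a Laurent polynomial on the projective line are 0 and \<open>\<infinity>\<close>. Regularity
  at 0 makes it a polynomial, and regularity at \<open>\<infinity>\<close> then bounds the degree by 0.\<close>

lemma laurent_regular_is_const:
  assumes "x \<in> laurent" "\<And>\<epsilon>. x \<in> val_ring \<epsilon>"
  obtains c where "x = const c"
proof (cases "x = 0")
  case True
  then show ?thesis using that[of 0] by simp
next
  case False
  obtain p m where x: "x = Fract p 1 * tvar powi m" using assms(1) unfolding laurent_def by blast
  have p0: "p \<noteq> 0" using False x by (auto simp: fract_collapse)
  then obtain q where q: "p = [:0, 1:] ^ order 0 p * q"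
    using order_decomp[of p 0] by auto
  then have q0: "q \<noteq> 0" using p0 by auto
  define k where "k = int (order 0 p) + m"
  have nz: "Fract p 1 \<noteq> 0" using False x by auto
  have vx: "val \<epsilon> x = poly_val \<epsilon> p + m * val \<epsilon> (tvar :: 'a ratfun)" for \<epsilon>
    using p0 nz unfolding x by (subst val_mult) (auto simp: val_power_int val_Fract poly_val.simps, (cases \<epsilon>, auto)+)
  have "0 \<le> k" using vx[of Pos] assms(2)[of Pos] False by (simp add: k_def val_tvar val_ring_def)
  moreover have "degree p = order 0 p + degree q"
    using q0 by (subst q) (simp add: degree_mult_eq degree_power_eq)
  moreover have "int (degree p) + m \<le> 0"
    using vx[of Neg] assms(2)[of Neg] False by (simp add: val_tvar val_ring_def)
  ultimately have k: "k = 0" and "degree q = 0" by (auto simp: k_def)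
  then obtain c where c: "q = [:c:]" by (meson degree_eq_zeroE)
  have "[:0, 1:] ^ i = monom (1 :: 'a) i" for i
    by (induction i) (simp_all add: monom_0 monom_Suc one_pCons)
  then have "Fract ([:0, 1:] ^ i) 1 = (tvar :: 'a ratfun) ^ i" for i
    by (simp add: tvar_power)
  then have "x = tvar ^ order 0 p * const c * tvar powi m"
    unfolding x const_def by (metis c q mult_fract mult_1)
  also have "\<dots> = const c * tvar powi k"
    by (simp add: k_def power_int_add)
  finally show ?thesis using that k by simp
qed

definition max_ideal :: "'k::field ratfun set" where
  "max_ideal = {x. x = 0 \<or> 0 < val Pos x}"

lemma max_ideal_subset: "x \<in> max_ideal \<Longrightarrow> x \<in> val_ring Pos"
  by (auto simp: max_ideal_def val_ring_def)

lemma max_ideal_add: "x \<in> max_ideal \<Longrightarrow> y \<in> max_ideal \<Longrightarrow> x + y \<in> max_ideal"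
  using val_add[of x y Pos] unfolding max_ideal_def
  by (cases "x = 0"; cases "y = 0"; cases "x + y = 0") auto

lemma max_ideal_diff: "x \<in> max_ideal \<Longrightarrow> y \<in> max_ideal \<Longrightarrow> x - y \<in> max_ideal"
  using max_ideal_add[of x "- y"] by (simp add: max_ideal_def val_minus)

lemma max_ideal_mult: "x \<in> max_ideal \<Longrightarrow> y \<in> val_ring Pos \<Longrightarrow> x * y \<in> max_ideal"
  unfolding max_ideal_def val_ring_def by (cases "x = 0"; cases "y = 0") (auto simp: val_mult)

lemma const_in_max_ideal: "const c \<in> max_ideal \<longleftrightarrow> c = 0"
  by (cases "c = 0") (simp_all add: max_ideal_def val_const)

lemma max_ideal_iff: "x \<in> max_ideal \<longleftrightarrow> (\<exists>y\<in>val_ring Pos. x = tvar * y)"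
proof
  assume "x \<in> max_ideal"
  then have "x / tvar \<in> val_ring Pos"
    unfolding max_ideal_def val_ring_def
    by (cases "x = 0") (simp_all add: divide_inverse val_mult val_inverse val_tvar)
  then show "\<exists>y\<in>val_ring Pos. x = tvar * y" by (intro bexI[of _ "x / tvar"]) simp_all
next
  show "\<exists>y\<in>val_ring Pos. x = tvar * y \<Longrightarrow> x \<in> max_ideal"
    using max_ideal_mult[of tvar] by (metis (mono_tags, lifting) max_ideal_def mem_Collect_eq val_tvar(1) zero_less_one)
qed

text \<open>Evaluation at \<open>t = 0\<close>: a ring homomorphism on the valuation ring, with unspecified values
  outside of it.\<close>

definition residue :: "'k::field ratfun \<Rightarrow> 'k" where
  "residue x = (THE c. x - const c \<in> max_ideal)"

lemma residue_unique: "x - const c \<in> max_ideal \<Longrightarrow> residue x = c"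
  unfolding residue_def
proof (rule the_equality)
  fix d assume "x - const c \<in> max_ideal" "x - const d \<in> max_ideal"
  then have "const (d - c) \<in> max_ideal" using max_ideal_diff[of "x - const c" "x - const d"] by simp
  then show "d = c" by (simp only: const_in_max_ideal) simp
qed

text \<open>Cancelling the common power of \<open>t\<close> leaves a denominator that does not vanish at 0; the
  residue is then the quotient of the values at 0.\<close>

lemma residue_diff:
  fixes x :: "'k::field ratfun"
  assumes "x \<in> val_ring Pos"
  shows "x - const (residue x) \<in> max_ideal"
proof -
  have "\<exists>c. x - const c \<in> max_ideal"
  proof (cases "x = 0")
    case True
    then have "x - const 0 \<in> max_ideal" by (simp add: max_ideal_def)
    then show ?thesis by blast
  next
    case False
    then obtain p q where x: "x = Fract p q" "p \<noteq> 0" "q \<noteq> 0" using ratfun_nonzero_cases by blast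
    obtain q' where q': "q = [:0, 1:] ^ order 0 q * q'" "\<not> [:0, 1:] dvd q'"
      using order_decomp[of q 0] x by auto
    have "order 0 q \<le> order 0 p" using assms False x by (simp add: val_ring_def val_Fract)
    then have "[:0, 1:] ^ order 0 q dvd p"
      using order_divides[of 0 "order 0 q" p] by simp
    then obtain p' where p': "p = [:0, 1:] ^ order 0 q * p'" by (rule dvdE)
    have "q' \<noteq> 0" using q'(2) by auto
    then have x': "x = Fract p' q'"
      unfolding x(1) using x(3) by (subst eq_fract) (simp_all add: p', metis p' q'(1) mult.assoc mult.commute)
    have q0: "poly q' 0 \<noteq> 0" using q'(2) poly_eq_0_iff_dvd[of q' 0] by simp
    define c where "c = poly p' 0 / poly q' 0"
    let ?r = "p' - [:c:] * q'"
    have "poly ?r 0 = 0" using q0 by (simp add: c_def)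
    then have "?r = 0 \<or> 0 < order 0 ?r" by (metis order_root gr0I)
    moreover have "order 0 q' = 0" using q0 by (rule order_0I)
    moreover have "x - const c = Fract ?r q'"
      using \<open>q' \<noteq> 0\<close> by (simp add: x' const_def)
    ultimately have "x - const c \<in> max_ideal"
      using \<open>q' \<noteq> 0\<close> unfolding max_ideal_def
      by (cases "?r = 0") (simp_all add: val_Fract fract_collapse)
    then show ?thesis by blast
  qed
  then show ?thesis using residue_unique by metis
qed

lemma residue_eq_0: "x \<in> val_ring Pos \<Longrightarrow> residue x = 0 \<longleftrightarrow> x \<in> max_ideal"
  using residue_diff[of x] residue_unique[of x 0] by auto

lemma residue_const [simp]: "residue (const c) = c"
  by (rule residue_unique) (simp add: max_ideal_def)

lemma residue_0 [simp]: "residue 0 = 0" and residue_1 [simp]: "residue 1 = 1"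
  using residue_const[of 0] residue_const[of 1] by simp_all

lemma residue_add:
  "x \<in> val_ring Pos \<Longrightarrow> y \<in> val_ring Pos \<Longrightarrow> residue (x + y) = residue x + residue y"
  using max_ideal_add[OF residue_diff[of x] residue_diff[of y]]
  by (intro residue_unique) (simp add: algebra_simps)

lemma residue_mult:
  assumes "x \<in> val_ring Pos" "y \<in> val_ring Pos"
  shows "residue (x * y) = residue x * residue y"
proof (rule residue_unique)
  have "x * y - const (residue x * residue y) =
      (x - const (residue x)) * y + (y - const (residue y)) * const (residue x)"
    by (simp add: algebra_simps)
  also have "\<dots> \<in> max_ideal"
    using assms by (intro max_ideal_add max_ideal_mult residue_diff const_in_val_ring)
  finally show "x * y - const (residue x * residue y) \<in> max_ideal" .
qed

lemma residue_sum:
  assumes "\<And>i. i \<in> I \<Longrightarrow> f i \<in> val_ring Pos"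
  shows "residue (sum f I) = (\<Sum>i\<in>I. residue (f i))"
  using assms
proof (induction I rule: infinite_finite_induct)
  case (insert i I)
  then have "residue (f i + sum f I) = residue (f i) + residue (sum f I)"
    by (intro residue_add subring_sum[OF is_subring_val_ring]) auto
  with insert show ?case by simp
qed simp_all

definition const_vec :: "'k::field ^ 'n \<Rightarrow> 'k ratfun ^ 'n" where
  "const_vec v = (\<chi> i. const (v $ i))"

definition residue_vec :: "'k::field ratfun ^ 'n \<Rightarrow> 'k ^ 'n" where
  "residue_vec v = (\<chi> i. residue (v $ i))"

abbreviation "const_mat \<equiv> map_matrix const"
abbreviation "residue_mat \<equiv> map_matrix residue"

lemma const_vec_in_vecs: "const_vec v \<in> vecs (val_ring \<epsilon>)"
  by (simp add: vecs_def const_vec_def const_in_val_ring)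

lemma const_mat_in_mats: "const_mat h \<in> mats (val_ring \<epsilon>)"
  by (simp add: mats_def const_in_val_ring)

lemma const_mat_mult: "const_mat (h ** h') = const_mat h ** const_mat h'"
  by (simp add: vec_eq_iff matrix_matrix_mult_def const_sum)

lemma const_mat_1: "const_mat (mat 1) = mat 1"
  by (simp add: vec_eq_iff mat_def)

lemma const_mat_sum: "const_mat (sum f I) = (\<Sum>i\<in>I. const_mat (f i))"
  by (simp add: vec_eq_iff const_sum)

lemma const_mat_vec: "const_mat h *v const_vec v = const_vec (h *v v)"
  by (simp add: vec_eq_iff const_vec_def matrix_vector_mult_def const_sum)

lemma residue_const_vec [simp]: "residue_vec (const_vec v) = v"
  by (simp add: vec_eq_iff const_vec_def residue_vec_def)

lemma residue_const_mat [simp]: "residue_mat (const_mat h) = h"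
  by (simp add: vec_eq_iff)

lemma residue_mat_1 [simp]: "residue_mat (mat 1) = mat 1"
  by (simp add: vec_eq_iff mat_def)

lemma residue_mat_vec:
  "B \<in> mats (val_ring Pos) \<Longrightarrow> y \<in> vecs (val_ring Pos) \<Longrightarrow>
    residue_vec (B *v y) = residue_mat B *v residue_vec y"
  by (simp add: vec_eq_iff residue_vec_def matrix_vector_mult_def vecs_def mats_def residue_sum
      residue_mult subring_closed[OF is_subring_val_ring])

lemma residue_mat_mult:
  "B \<in> mats (val_ring Pos) \<Longrightarrow> C \<in> mats (val_ring Pos) \<Longrightarrow>
    residue_mat (B ** C) = residue_mat B ** residue_mat C"
  by (simp add: vec_eq_iff matrix_matrix_mult_def mats_def residue_sum
      residue_mult subring_closed[OF is_subring_val_ring])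

text \<open>Divide by an entry of least valuation. The entry 1 is kept by reduction modulo \<open>t\<close>, so this
  produces vectors with nonzero residue on every line of \<open>K\<^sup>n\<close>.\<close>

lemma nonzero_vec_scale:
  fixes v :: "'k::field ratfun ^ 'n"
  assumes "v \<noteq> 0"
  obtains c i where "c \<noteq> 0" "c *s v \<in> vecs (val_ring \<epsilon>)" "(c *s v) $ i = 1"
proof -
  let ?I = "{i. v $ i \<noteq> 0}"
  have "?I \<noteq> {}" using assms by (auto simp: vec_eq_iff)
  then obtain i where i: "i \<in> ?I" "\<And>j. j \<in> ?I \<Longrightarrow> val \<epsilon> (v $ i) \<le> val \<epsilon> (v $ j)"
    using finite_has_minimal[of "(\<lambda>i. val \<epsilon> (v $ i)) ` ?I"]
    by (metis (mono_tags, lifting) arg_min_if_finite(1) arg_min_least finite)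
  have "inverse (v $ i) * v $ j \<in> val_ring \<epsilon>" for j
    using i by (cases "v $ j = 0") (simp_all add: val_ring_def val_mult val_inverse)
  then have "inverse (v $ i) *s v \<in> vecs (val_ring \<epsilon>)" by (simp add: vecs_def)
  with i(1) show ?thesis by (intro that[of "inverse (v $ i)" i]) auto
qed


section \<open>Lattices and their determinants\<close>

definition lattice_of :: "polarity \<Rightarrow> 'k::field ratfun ^ 'n ^ 'n \<Rightarrow> ('k ratfun ^ 'n) set" where
  "lattice_of \<epsilon> B = (*v) B ` vecs (val_ring \<epsilon>)"

definition column_matrix :: "('n \<Rightarrow> 'a ^ 'n) \<Rightarrow> 'a ^ 'n ^ 'n" where
  "column_matrix f = (\<chi> i j. f j $ i)"

definition tvar_diag :: "('n \<Rightarrow> int) \<Rightarrow> 'k::field ratfun ^ 'n ^ 'n" where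
  "tvar_diag a = (\<chi> i j. if i = j then tvar powi a i else 0)"

lemma column_matrix_vec:
  "column_matrix f *v y = (\<Sum>i\<in>UNIV. y $ i *s (f i :: 'a::field ^ 'n))"
  by (simp add: vec_eq_iff column_matrix_def matrix_vector_mult_def mult.commute[of "f _ $ _"])

lemma lincombs_column_matrix: "lincombs S f = (*v) (column_matrix f) ` vecs S"
proof (intro equalityI subsetI)
  fix v assume "v \<in> lincombs S f"
  then obtain c where c: "v = (\<Sum>i\<in>UNIV. c i *s f i)" "\<forall>i. c i \<in> S" unfolding lincombs_def by blast
  then have "v = column_matrix f *v (\<chi> i. c i)" "(\<chi> i. c i) \<in> vecs S"
    by (simp_all add: column_matrix_vec vecs_def)
  then show "v \<in> (*v) (column_matrix f) ` vecs S" by blast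
next
  fix v assume "v \<in> (*v) (column_matrix f) ` vecs S"
  then obtain y where "v = column_matrix f *v y" "y \<in> vecs S" by blast
  then show "v \<in> lincombs S f" unfolding lincombs_def column_matrix_vec vecs_def by blast
qed

lemma tvar_diag_nth: "(tvar_diag a *v y) $ i = tvar powi a i * y $ i"
  by (simp add: tvar_diag_def matrix_vector_mult_def if_distrib[of "\<lambda>x. x * _"] cong: if_cong)

lemma tvar_diag_mult: "tvar_diag a ** tvar_diag b = tvar_diag (\<lambda>i. a i + b i)"
  by (simp add: matrix_eq vec_eq_iff power_int_add tvar_diag_nth mult.assoc flip: matrix_vector_mul_assoc)

lemma tvar_diag_0: "tvar_diag (\<lambda>i. 0) = mat 1"
  by (simp add: tvar_diag_def mat_def vec_eq_iff)

lemma tvar_diag_inverse: "tvar_diag a ** tvar_diag (\<lambda>i. - a i) = mat 1"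
  by (simp add: tvar_diag_mult tvar_diag_0)

lemma invertible_tvar_diag: "invertible (tvar_diag a)"
  using tvar_diag_inverse invertible_right_inverse by blast

lemma column_matrix_scaled:
  "column_matrix (\<lambda>i. tvar powi a i *s f i) = column_matrix f ** tvar_diag a"
  by (simp add: matrix_eq column_matrix_vec tvar_diag_nth mult.commute flip: matrix_vector_mul_assoc)

lemma apt_vertex_lattice_of:
  "apt_vertex \<epsilon> f a = hclass (lattice_of \<epsilon> (column_matrix f ** tvar_diag a))"
  by (simp add: apt_vertex_def lincombs_column_matrix column_matrix_scaled lattice_of_def)

text \<open>A linear relation over \<open>K\<close> can be scaled to one over the valuation ring with a coefficient 1,
  so a basis of a lattice is a basis of \<open>K\<^sup>n\<close>.\<close>

lemma invertible_if_injective_on_val_ring: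
  fixes B :: "'k::field ratfun ^ 'n ^ 'n"
  assumes "\<And>y. y \<in> vecs (val_ring \<epsilon>) \<Longrightarrow> B *v y = 0 \<Longrightarrow> y = 0"
  shows "invertible B"
proof -
  have "x = 0" if "B *v x = 0" for x
  proof (rule ccontr)
    assume "x \<noteq> 0"
    then obtain c i where c: "c *s x \<in> vecs (val_ring \<epsilon>)" "(c *s x) $ i = 1"
      using nonzero_vec_scale by metis
    have "B *v (c *s x) = 0" using that by (simp add: matrix_scalar_mult)
    with assms c(1) have "c *s x = 0" by blast
    with c(2) show False by (metis zero_index zero_neq_one)
  qed
  then show ?thesis unfolding invertible_left_inverse matrix_left_invertible_ker by blast
qed

lemma is_lattice_iff: "is_lattice \<epsilon> L \<longleftrightarrow> (\<exists>B. invertible B \<and> L = lattice_of \<epsilon> B)"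
proof
  assume "is_lattice \<epsilon> L"
  then obtain f where f: "L = lincombs (val_ring \<epsilon>) f"
    "\<And>c. (\<forall>i. c i \<in> val_ring \<epsilon>) \<Longrightarrow> (\<Sum>i\<in>UNIV. c i *s f i) = 0 \<Longrightarrow> (\<forall>i. c i = 0)"
    unfolding is_lattice_def free_basis_def by blast
  have "invertible (column_matrix f)"
  proof (rule invertible_if_injective_on_val_ring)
    fix y assume "y \<in> vecs (val_ring \<epsilon>)" "column_matrix f *v y = 0"
    then have "\<forall>i. y $ i \<in> val_ring \<epsilon>" "(\<Sum>i\<in>UNIV. y $ i *s f i) = 0"
      by (simp_all add: column_matrix_vec vecs_def)
    then have "\<forall>i. y $ i = 0" by (rule f(2)[of "\<lambda>i. y $ i"])
    then show "y = 0" by (simp add: vec_eq_iff)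
  qed
  with f(1) show "\<exists>B. invertible B \<and> L = lattice_of \<epsilon> B"
    unfolding lincombs_column_matrix lattice_of_def by blast
next
  assume "\<exists>B. invertible B \<and> L = lattice_of \<epsilon> B"
  then obtain B where B: "invertible B" "L = lattice_of \<epsilon> B" by blast
  define f where "f = (\<lambda>j. column j B)"
  have Bf: "B = column_matrix f" by (simp add: f_def column_matrix_def column_def vec_eq_iff)
  have "c i = 0" if "(\<Sum>i\<in>UNIV. c i *s f i) = 0" for c i
  proof -
    have "B *v (\<chi> i. c i) = (\<Sum>i\<in>UNIV. c i *s f i)" by (simp add: Bf column_matrix_vec)
    then have "B *v (\<chi> i. c i) = 0" using that by simp
    then have "(\<chi> i. c i) = 0"
      by (metis B(1) invertible_left_inverse matrix_left_invertible_ker)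
    then show ?thesis by (simp add: vec_eq_iff)
  qed
  moreover have "L = lincombs (val_ring \<epsilon>) f"
    by (simp only: B(2) lattice_of_def lincombs_column_matrix flip: Bf)
  ultimately have "free_basis (val_ring \<epsilon>) f L" by (simp add: free_basis_def)
  then show "is_lattice \<epsilon> L" unfolding is_lattice_def by blast
qed

lemma mat_vector_mult: "mat c *v x = c *s (x :: 'a::field ^ 'n)"
  by (simp add: vec_eq_iff matrix_vector_mult_def mat_def if_distrib[of "\<lambda>x. x * _"] cong: if_cong)

lemma matrix_image_lattice_of: "(*v) g ` lattice_of \<epsilon> B = lattice_of \<epsilon> (g ** B)"
  by (simp add: lattice_of_def image_image matrix_vector_mul_assoc)

lemma scale_image_lattice_of: "(*s) c ` lattice_of \<epsilon> B = lattice_of \<epsilon> (mat c ** B)"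
  by (simp add: lattice_of_def image_image mat_vector_mult flip: matrix_vector_mul_assoc)

lemma det_mat: "det (mat c :: 'a::field ^ 'n ^ 'n) = c ^ CARD('n)"
  by (subst det_diagonal) (simp_all add: mat_def)

lemma invertible_mat: "c \<noteq> 0 \<Longrightarrow> invertible (mat c :: 'a::field ^ 'n ^ 'n)"
  by (simp add: invertible_det_nz det_mat)

lemma lattice_of_subset_iff:
  assumes "C ** B' = mat 1"
  shows "lattice_of \<epsilon> B \<subseteq> lattice_of \<epsilon> B' \<longleftrightarrow> C ** B \<in> mats (val_ring \<epsilon>)"
proof -
  have B'C: "B' ** C = mat 1" using assms matrix_left_right_inverse by blast
  have "lattice_of \<epsilon> B \<subseteq> lattice_of \<epsilon> B' \<longleftrightarrow> (*v) (C ** B) ` vecs (val_ring \<epsilon>) \<subseteq> vecs (val_ring \<epsilon>)"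
  proof
    assume sub: "lattice_of \<epsilon> B \<subseteq> lattice_of \<epsilon> B'"
    have "(*v) C ` lattice_of \<epsilon> B' = vecs (val_ring \<epsilon>)"
      by (simp add: lattice_of_def image_image matrix_cancel(1)[OF assms])
    then show "(*v) (C ** B) ` vecs (val_ring \<epsilon>) \<subseteq> vecs (val_ring \<epsilon>)"
      using sub by (fastforce simp: lattice_of_def simp flip: matrix_vector_mul_assoc)
  next
    assume sub: "(*v) (C ** B) ` vecs (val_ring \<epsilon>) \<subseteq> vecs (val_ring \<epsilon>)"
    have "B *v y = B' *v ((C ** B) *v y)" for y
      by (simp add: matrix_cancel[OF B'C] flip: matrix_vector_mul_assoc)
    with sub show "lattice_of \<epsilon> B \<subseteq> lattice_of \<epsilon> B'" unfolding lattice_of_def by blast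
  qed
  then show ?thesis
    using matrix_in_mats[OF is_subring_val_ring] matrix_vector_in_vecs[OF is_subring_val_ring]
    by blast
qed

text \<open>The matrix that expresses a basis of the smaller lattice through one of the larger has entries in
  the valuation ring, hence a determinant of nonnegative valuation; if the valuation is 0, Cramer's
  rule inverts it. Thus the valuation of the determinant of a basis plays the role of an index,
  which increases strictly when the lattice shrinks.\<close>

lemma lattice_of_subset_det:
  fixes B B' :: "'k::field ratfun ^ 'n ^ 'n"
  assumes inv: "invertible B" "invertible B'" and sub: "lattice_of \<epsilon> B \<subseteq> lattice_of \<epsilon> B'"
  shows "val \<epsilon> (det B') \<le> val \<epsilon> (det B)"
    and "val \<epsilon> (det B) = val \<epsilon> (det B') \<Longrightarrow> lattice_of \<epsilon> B = lattice_of \<epsilon> B'"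
proof -
  obtain C where C: "C ** B' = mat 1" "B' ** C = mat 1" using inv(2) invertible_obtain by metis
  have CB: "C ** B \<in> mats (val_ring \<epsilon>)" using sub lattice_of_subset_iff[OF C(1)] by blast
  have nz: "det B \<noteq> 0" "det B' \<noteq> 0" using inv by (simp_all add: invertible_det_nz)
  have B: "B = B' ** (C ** B)" by (simp add: matrix_cancel[OF C(2)])
  then have dB: "det B = det B' * det (C ** B)" using det_mul by metis
  then have nzC: "det (C ** B) \<noteq> 0" using nz by auto
  have v: "val \<epsilon> (det B) = val \<epsilon> (det B') + val \<epsilon> (det (C ** B))"
    using dB nzC nz by (simp add: val_mult)
  have "det (C ** B) \<in> val_ring \<epsilon>" by (rule det_in_subring[OF is_subring_val_ring CB])
  then show "val \<epsilon> (det B') \<le> val \<epsilon> (det B)" using v nzC by (simp add: val_ring_def)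
  assume "val \<epsilon> (det B) = val \<epsilon> (det B')"
  then have "inverse (det (C ** B)) \<in> val_ring \<epsilon>"
    using v nzC by (simp add: val_ring_def val_inverse)
  then have "(*v) (C ** B) ` vecs (val_ring \<epsilon>) = vecs (val_ring \<epsilon>)"
    by (intro vecs_image_eq_if_unit_det is_subring_val_ring CB nzC)
  then have "(*v) B' ` (*v) (C ** B) ` vecs (val_ring \<epsilon>) = lattice_of \<epsilon> B'"
    by (simp only: lattice_of_def)
  moreover have "(*v) B' ` (*v) (C ** B) ` vecs (val_ring \<epsilon>) = lattice_of \<epsilon> B"
    by (subst (2) B) (simp add: lattice_of_def image_image flip: matrix_vector_mul_assoc)
  ultimately show "lattice_of \<epsilon> B = lattice_of \<epsilon> B'" by simp
qed

lemma unit_scale_lattice_of: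
  fixes B :: "'k::field ratfun ^ 'n ^ 'n"
  assumes "c \<noteq> 0" "val \<epsilon> c = 0"
  shows "(*s) c ` lattice_of \<epsilon> B = lattice_of \<epsilon> B"
proof -
  have sub: "(*s) e ` lattice_of \<epsilon> B \<subseteq> lattice_of \<epsilon> B" if "e \<in> val_ring \<epsilon>" for e
  proof -
    have "e *s (B *v y) = B *v (e *s y)" for y by (simp add: matrix_scalar_mult)
    moreover have "e *s y \<in> vecs (val_ring \<epsilon>)" if "y \<in> vecs (val_ring \<epsilon>)" for y :: "'k ratfun ^ 'n"
      using that \<open>e \<in> val_ring \<epsilon>\<close> subring_closed(6)[OF is_subring_val_ring]
      by (auto simp: vecs_def)
    ultimately show ?thesis by (force simp: lattice_of_def)
  qed
  have "c \<in> val_ring \<epsilon>" "inverse c \<in> val_ring \<epsilon>" using assms by (simp_all add: val_ring_def val_inverse)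
  then have "(*s) c ` lattice_of \<epsilon> B \<subseteq> lattice_of \<epsilon> B"
    and 2: "(*s) (inverse c) ` lattice_of \<epsilon> B \<subseteq> lattice_of \<epsilon> B" using sub by blast+
  moreover have "lattice_of \<epsilon> B \<subseteq> (*s) c ` lattice_of \<epsilon> B"
  proof
    fix v assume "v \<in> lattice_of \<epsilon> B"
    with 2 have "inverse c *s v \<in> lattice_of \<epsilon> B" by blast
    then have "c *s (inverse c *s v) \<in> (*s) c ` lattice_of \<epsilon> B" by blast
    then show "v \<in> (*s) c ` lattice_of \<epsilon> B" using assms(1) by simp
  qed
  ultimately show ?thesis by blast
qed

lemma hclass_matrix_image: "image ((*v) g) ` hclass L = hclass ((*v) g ` L)"
proof -
  have "(*v) g ` (*s) c ` L = (*s) c ` (*v) g ` L" for c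
    by (simp add: image_image matrix_scalar_mult)
  then show ?thesis unfolding hclass_def setcompr_eq_image image_image by (intro image_cong) (simp_all add: matrix_scalar_mult)
qed

section \<open>Elements of determinant one fixing a simplex\<close>

text \<open>Type preservation. The index of a lattice does not change under \<open>g\<close> and changes by a multiple
  of \<open>n\<close> under homothety, while the indices along the chain of a simplex differ by less than \<open>n\<close>.
  So \<open>g\<close> cannot send the class of a lattice of the chain to that of another one, and the scalar by
  which it could stretch a lattice is a unit.\<close>

lemma fixed_simplex_stabilizes_lattices:
  fixes g :: "'k::field ratfun ^ 'n ^ 'n"
  assumes \<sigma>: "\<sigma> \<in> simplices \<epsilon>" and g: "det g = 1" "act_simplex g \<sigma> = \<sigma>"
    and v: "v \<in> \<sigma>" and M: "M \<in> v"
  shows "(*v) g ` M = M"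
proof -
  let ?\<pi> = "uniformizer \<epsilon> :: 'k ratfun" and ?n = "int CARD('n)"
  obtain q L where L: "\<And>i. i \<le> q \<Longrightarrow> is_lattice \<epsilon> (L i)" "\<And>i. i < q \<Longrightarrow> L (Suc i) \<subset> L i"
    "(*s) ?\<pi> ` L 0 \<subset> L q" "\<sigma> = (\<lambda>i. hclass (L i)) ` {..q}"
    using \<sigma> unfolding simplices_def by (elim CollectE exE conjE) (rule that; simp)
  have "\<forall>i. \<exists>B. i \<le> q \<longrightarrow> invertible B \<and> L i = lattice_of \<epsilon> B"
    using L(1) unfolding is_lattice_iff by blast
  then obtain B where B: "\<And>i. i \<le> q \<Longrightarrow> invertible (B i)" "\<And>i. i \<le> q \<Longrightarrow> L i = lattice_of \<epsilon> (B i)"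
    by metis
  define d where "d i = val \<epsilon> (det (B i))" for i
  have \<pi>: "?\<pi> \<noteq> 0" by (cases \<epsilon>) simp_all
  have inv_scaled: "invertible (mat c ** B i)" if "c \<noteq> 0" "i \<le> q" for c i
    using that B(1) invertible_mult invertible_mat by blast
  have d_scaled: "val \<epsilon> (det (mat c ** B i)) = ?n * val \<epsilon> c + d i" if "c \<noteq> 0" "i \<le> q" for c i
    using that B(1)[of i] by (simp add: det_mul det_mat val_mult val_power d_def invertible_det_nz)
  have mono: "L j \<subseteq> L i" if "i \<le> j" "j \<le> q" for i j
    using that
  proof (induction rule: dec_induct)
    case (step m)
    then show ?case using L(2)[of m] by fastforce
  qed simp
  have bounds: "d i \<le> d j" "d j < ?n + d i" if ij: "i \<le> j" "j \<le> q" for i j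
  proof -
    have i: "i \<le> q" using ij by simp
    show "d i \<le> d j" unfolding d_def
      by (rule lattice_of_subset_det) (use mono[OF ij] B ij i in auto)
    have "(*s) ?\<pi> ` L i \<subseteq> (*s) ?\<pi> ` L 0" using mono[of 0 i] i by blast
    then have strict: "lattice_of \<epsilon> (mat ?\<pi> ** B i) \<subset> lattice_of \<epsilon> (B j)"
      using L(3) mono[OF ij(2)] B(2)[OF i] B(2)[OF ij(2)] by (auto simp flip: scale_image_lattice_of)
    have "d j \<le> ?n + d i \<and> d j \<noteq> ?n + d i"
      using lattice_of_subset_det[OF inv_scaled[OF \<pi> i] B(1)[OF ij(2)] psubset_imp_subset[OF strict]]
        strict d_scaled[OF \<pi> i]
      by (auto simp: val_uniformizer d_def)
    then show "d j < ?n + d i" by simp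
  qed
  obtain i where i: "i \<le> q" "v = hclass (L i)" using v L(4) by blast
  then obtain c where c: "M = (*s) c ` L i" using M unfolding hclass_def by blast
  have "hclass ((*v) g ` L i) \<in> act_simplex g \<sigma>"
    using v unfolding act_simplex_def i(2) hclass_matrix_image[symmetric] by blast
  then obtain j where j: "j \<le> q" "hclass ((*v) g ` L i) = hclass (L j)" using g(2) L(4) by auto
  then have "(*v) g ` L i \<in> hclass (L j)" using hclass_self by metis
  then obtain e where e: "e \<noteq> 0" "(*v) g ` L i = (*s) e ` L j" unfolding hclass_def by blast
  then have gB: "lattice_of \<epsilon> (g ** B i) = lattice_of \<epsilon> (mat e ** B j)"
    using B(2) i(1) j(1) by (simp add: matrix_image_lattice_of scale_image_lattice_of)
  have "invertible (g ** B i)" using g(1) B(1)[OF i(1)] by (simp add: invertible_det_nz det_mul)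
  then have "val \<epsilon> (det (g ** B i)) = val \<epsilon> (det (mat e ** B j))"
    using gB inv_scaled[OF e(1) j(1)] by (metis antisym lattice_of_subset_det(1) order_refl)
  then have dij: "d i = ?n * val \<epsilon> e + d j"
    using d_scaled[OF e(1) j(1)] g(1) by (simp add: det_mul d_def)
  have "\<bar>d i - d j\<bar> < ?n" using bounds[of i j] bounds[of j i] i(1) j(1) by linarith
  then have "\<bar>?n * val \<epsilon> e\<bar> < ?n" using dij by simp
  then have "?n * \<bar>val \<epsilon> e\<bar> < ?n * 1" by (simp add: abs_mult)
  then have ve: "val \<epsilon> e = 0" by (subst (asm) mult_less_cancel_left_pos) auto
  then have d_eq: "d i = d j" using dij by simp
  have "L i = L j"
  proof (cases "i \<le> j")
    case True
    then show ?thesis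
      using lattice_of_subset_det(2)[of "B j" "B i" \<epsilon>] d_eq mono[OF True j(1)] B i(1) j(1)
      by (simp add: d_def)
  next
    case False
    then show ?thesis
      using lattice_of_subset_det(2)[of "B i" "B j" \<epsilon>] d_eq mono[of j i] B i(1) j(1)
      by (simp add: d_def)
  qed
  then have "(*v) g ` L i = L i"
    using e ve B(2)[OF i(1)] unit_scale_lattice_of by metis
  then show ?thesis
    unfolding c by (simp add: image_image matrix_scalar_mult) (metis image_image)
qed

section \<open>Opposite simplices and common frames\<close>

lemma laurent_vecs_eq: "laurent_vecs = vecs laurent"
  by (simp add: laurent_vecs_def vecs_def)

text \<open>Equivalently, the columns of \<open>P\<close> form an \<open>R\<close>-basis of \<open>R\<^sup>n\<close>.\<close>

definition laurent_frame :: "'k::field ratfun ^ 'n ^ 'n \<Rightarrow> bool" where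
  "laurent_frame P \<longleftrightarrow> invertible P \<and> (*v) P ` laurent_vecs = laurent_vecs"

lemma tvar_powi_laurent: "tvar powi m \<in> laurent"
proof -
  have "tvar powi m = Fract 1 1 * tvar powi m" by (simp add: fract_collapse)
  then show ?thesis unfolding laurent_def by blast
qed

lemma laurent_frame_tvar_diag: "laurent_frame (tvar_diag a :: 'k::field ratfun ^ 'n ^ 'n)"
proof -
  have sub: "(*v) (tvar_diag a) ` laurent_vecs \<subseteq> (laurent_vecs :: ('k ratfun ^ 'n) set)" for a
    by (auto simp: laurent_vecs_def tvar_diag_nth intro!: laurent_mult tvar_powi_laurent)
  have "(laurent_vecs :: ('k ratfun ^ 'n) set) \<subseteq> (*v) (tvar_diag a) ` laurent_vecs"
  proof
    fix v :: "'k ratfun ^ 'n" assume "v \<in> laurent_vecs"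
    then have "tvar_diag (\<lambda>i. - a i) *v v \<in> laurent_vecs" using sub by blast
    then show "v \<in> (*v) (tvar_diag a) ` laurent_vecs"
      by (intro image_eqI[of _ _ "tvar_diag (\<lambda>i. - a i) *v v"]) (simp_all add: matrix_cancel(1)[OF tvar_diag_inverse])
  qed
  with sub[of a] have "(*v) (tvar_diag a) ` laurent_vecs = (laurent_vecs :: ('k ratfun ^ 'n) set)" ..
  then show ?thesis by (simp add: laurent_frame_def invertible_tvar_diag)
qed

lemma laurent_frame_mult: "laurent_frame P \<Longrightarrow> laurent_frame Q \<Longrightarrow> laurent_frame (P ** Q)"
proof -
  assume PQ: "laurent_frame P" "laurent_frame Q"
  have "(*v) (P ** Q) ` laurent_vecs = (*v) P ` (*v) Q ` laurent_vecs"
    by (simp add: image_image matrix_vector_mul_assoc)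
  then show ?thesis using PQ by (simp add: laurent_frame_def invertible_mult)
qed

lemma laurent_frame_column_matrix:
  assumes "free_basis laurent f laurent_vecs"
  shows "laurent_frame (column_matrix f)"
proof -
  have "x = 0" if "column_matrix f *v x = 0" for x
    using laurent_basis_indep[OF assms, of "\<lambda>i. x $ i"] that
    by (simp add: column_matrix_vec vec_eq_iff)
  then have "invertible (column_matrix f)"
    unfolding invertible_left_inverse matrix_left_invertible_ker by blast
  moreover have "(*v) (column_matrix f) ` laurent_vecs = laurent_vecs"
    using assms unfolding free_basis_def lincombs_column_matrix laurent_vecs_eq by simp
  ultimately show ?thesis by (simp add: laurent_frame_def)
qed

text \<open>Up to a unit of the valuation ring, a scalar is a power of \<open>t\<close>, and scaling by it shifts all
  exponents. Hence exponents can be chosen that describe a given lattice and not only its class,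
  and they define the same vertices of the apartment at both places.\<close>

lemma apt_vertex_member:
  fixes f :: "'n \<Rightarrow> 'k::field ratfun ^ 'n"
  assumes "L \<in> apt_vertex \<epsilon> f a"
  obtains b where "L = lattice_of \<epsilon> (column_matrix f ** tvar_diag b)"
    "\<And>\<epsilon>'. apt_vertex \<epsilon>' f b = apt_vertex \<epsilon>' f a"
proof -
  let ?F = "column_matrix f"
  obtain c where c: "c \<noteq> 0" "L = (*s) c ` lattice_of \<epsilon> (?F ** tvar_diag a)"
    using assms unfolding apt_vertex_lattice_of hclass_def by blast
  define m where "m = val \<epsilon> c * val \<epsilon> (tvar :: 'k ratfun)"
  define u where "u = c * tvar powi (- m)"
  have u: "u \<noteq> 0" "val \<epsilon> u = 0" using c(1) unfolding u_def m_def
    by (cases \<epsilon>; simp add: val_mult val_power_int val_tvar)+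
  have "c = u * tvar powi m" by (simp add: u_def power_int_minus)
  then have "L = (*s) u ` (*s) (tvar powi m) ` lattice_of \<epsilon> (?F ** tvar_diag a)"
    unfolding c(2) by (simp add: image_image)
  also have "\<dots> = (*s) u ` lattice_of \<epsilon> (mat (tvar powi m) ** (?F ** tvar_diag a))"
    by (simp only: scale_image_lattice_of)
  also have "mat (tvar powi m) ** (?F ** tvar_diag a) = ?F ** tvar_diag (\<lambda>i. a i + m)"
  proof -
    have "mat (tvar powi m) *v (?F *v (tvar_diag a *v x)) = ?F *v (tvar_diag (\<lambda>i. a i + m) *v x)" for x
    proof -
      have "tvar powi m *s (tvar_diag a *v x) = tvar_diag (\<lambda>i. a i + m) *v x"
        by (simp add: vec_eq_iff tvar_diag_nth power_int_add)
      then show ?thesis by (simp add: mat_vector_mult flip: matrix_scalar_mult)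
    qed
    then show ?thesis by (simp add: matrix_eq flip: matrix_vector_mul_assoc)
  qed
  finally have "L = lattice_of \<epsilon> (?F ** tvar_diag (\<lambda>i. a i + m))"
    by (simp add: unit_scale_lattice_of u)
  then show ?thesis using that apt_vertex_shift by blast
qed

text \<open>Opposition, restated for lattices instead of classes: one matrix spans a given lattice of
  \<open>\<sigma>\<close> at one place and a representative of the opposite vertex in \<open>\<tau>\<close> at the other.\<close>

lemma opposite_common_frame:
  assumes "opposite \<epsilon> \<sigma> \<tau>"
  obtains f where "free_basis laurent f laurent_vecs"
    "\<And>v L. v \<in> \<sigma> \<Longrightarrow> L \<in> v \<Longrightarrow> \<exists>a. L = lattice_of \<epsilon> (column_matrix f ** tvar_diag a) \<and>
      (\<exists>w\<in>\<tau>. lattice_of (opp \<epsilon>) (column_matrix f ** tvar_diag a) \<in> w)"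
proof -
  obtain f where f: "free_basis laurent f laurent_vecs" "\<sigma> \<subseteq> apartment f \<epsilon>" "op_apt f \<epsilon> ` \<sigma> = \<tau>"
    using assms unfolding opposite_def by (elim conjE exE) (rule that)
  show ?thesis
  proof (rule that[OF f(1)])
    fix v L assume v: "v \<in> \<sigma>" "L \<in> v"
    then obtain a where a: "v = apt_vertex \<epsilon> f a" using f(2) unfolding apartment_def by blast
    from v(2)[unfolded a] obtain b
      where b: "L = lattice_of \<epsilon> (column_matrix f ** tvar_diag b)"
        "\<And>\<epsilon>'. apt_vertex \<epsilon>' f b = apt_vertex \<epsilon>' f a"
      by (rule apt_vertex_member) (rule that)
    have "apt_vertex (opp \<epsilon>) f b \<in> \<tau>"
      using imageI[OF v(1), of "op_apt f \<epsilon>"] unfolding f(3) a op_apt_apt_vertex[OF f(1)] b(2) .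
    then have "\<exists>w\<in>\<tau>. lattice_of (opp \<epsilon>) (column_matrix f ** tvar_diag b) \<in> w"
      using hclass_self unfolding apt_vertex_lattice_of by blast
    with b(1) show "\<exists>a. L = lattice_of \<epsilon> (column_matrix f ** tvar_diag a) \<and>
      (\<exists>w\<in>\<tau>. lattice_of (opp \<epsilon>) (column_matrix f ** tvar_diag a) \<in> w)" by blast
  qed
qed


section \<open>Constant matrices of the action on a stable frame\<close>

text \<open>In the basis \<open>P\<close> the entries of \<open>g\<close> lie in \<open>R\<close>, because \<open>P\<close> is an \<open>R\<close>-basis of \<open>R\<^sup>n\<close>, and in
  both valuation rings, because both lattices are stable. Such functions are constant.\<close>

lemma frame_action_const:
  fixes P :: "'k::field ratfun ^ 'n ^ 'n"
  assumes P: "laurent_frame P" and g: "g \<in> mats laurent"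
    and stable: "\<And>\<epsilon>. (*v) g ` lattice_of \<epsilon> P = lattice_of \<epsilon> P"
  obtains h where "g ** P = P ** const_mat h"
proof -
  obtain P' where P': "P' ** P = mat 1" "P ** P' = mat 1"
    using P invertible_obtain unfolding laurent_frame_def by metis
  define X where "X = P' ** (g ** P)"
  have regular: "X \<in> mats (val_ring \<epsilon>)" for \<epsilon>
    using stable[of \<epsilon>] unfolding X_def lattice_of_subset_iff[OF P'(1), symmetric]
    by (simp add: matrix_image_lattice_of)
  have "X *v y \<in> laurent_vecs" if "y \<in> laurent_vecs" for y
  proof -
    have "P *v y \<in> laurent_vecs" using P that unfolding laurent_frame_def by blast
    then have "g *v (P *v y) \<in> laurent_vecs"
      using matrix_vector_in_vecs[OF is_subring_laurent g] unfolding laurent_vecs_eq by blast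
    then obtain z where "z \<in> laurent_vecs" "g *v (P *v y) = P *v z"
      using P unfolding laurent_frame_def by (metis imageE)
    then show ?thesis by (simp add: X_def matrix_cancel(1)[OF P'(1)] flip: matrix_vector_mul_assoc)
  qed
  then have "X \<in> mats laurent"
    unfolding laurent_vecs_eq by (intro matrix_in_mats is_subring_laurent) blast
  then have "X $ i $ j \<in> laurent" "\<And>\<epsilon>. X $ i $ j \<in> val_ring \<epsilon>" for i j
    using regular by (simp_all add: mats_def)
  then have "\<exists>c. X $ i $ j = const c" for i j by (metis laurent_regular_is_const)
  then obtain h where h: "\<And>i j. X $ i $ j = const (h i j)" by metis
  have "X = const_mat (\<chi> i j. h i j)" by (simp add: vec_eq_iff h)
  moreover have "g ** P = P ** X" by (simp add: X_def matrix_cancel(2)[OF P'(2)])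
  ultimately show ?thesis using that by blast
qed

lemma SL_laurent_subgroupD:
  assumes "subgroup \<Gamma> SL_laurent" "g \<in> \<Gamma>"
  shows "g \<in> mats laurent" "det g = 1" "\<exists>g'\<in>\<Gamma>. g ** g' = mat 1"
proof -
  interpret group SL_laurent by (rule group_SL_laurent)
  have g: "g \<in> carrier SL_laurent" using assms subgroup.mem_carrier by metis
  then show "g \<in> mats laurent" "det g = 1" by (auto simp: SL_laurent_def mats_def)
  have "g \<otimes>\<^bsub>SL_laurent\<^esub> inv\<^bsub>SL_laurent\<^esub> g = \<one>\<^bsub>SL_laurent\<^esub>" using g by (rule r_inv)
  then show "\<exists>g'\<in>\<Gamma>. g ** g' = mat 1"
    using subgroup.m_inv_closed[OF assms] by (auto simp: SL_laurent_def)
qed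

lemma stable_if_subset:
  assumes \<Gamma>: "subgroup \<Gamma> SL_laurent" and sub: "\<And>g. g \<in> \<Gamma> \<Longrightarrow> (*v) g ` L \<subseteq> L" and g: "g \<in> \<Gamma>"
  shows "(*v) g ` L = L"
proof -
  obtain g' where g': "g' \<in> \<Gamma>" "g ** g' = mat 1" using SL_laurent_subgroupD(3)[OF \<Gamma> g] by blast
  have "x \<in> (*v) g ` L" if "x \<in> L" for x
  proof (rule image_eqI)
    show "g' *v x \<in> L" using sub[OF g'(1)] that by blast
    show "x = g *v (g' *v x)" by (simp add: matrix_cancel(1)[OF g'(2)])
  qed
  then show ?thesis using sub[OF g] by blast
qed

text \<open>This is the way in which complete reducibility is used: the opposite simplex is fixed as well,
  so the lattices with the same symbol are stable at both places.\<close>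

lemma fixed_simplex_common_frame:
  assumes \<Gamma>: "subgroup \<Gamma> SL_laurent" and cr: "completely_reducible \<Gamma>"
    and \<sigma>: "\<sigma> \<in> fixed_simplices \<Gamma> Pos"
  obtains f where "free_basis laurent f laurent_vecs"
    "\<And>v L. v \<in> \<sigma> \<Longrightarrow> L \<in> v \<Longrightarrow> \<exists>a. L = lattice_of Pos (column_matrix f ** tvar_diag a) \<and>
      (\<forall>g\<in>\<Gamma>. \<forall>\<epsilon>. (*v) g ` lattice_of \<epsilon> (column_matrix f ** tvar_diag a) =
        lattice_of \<epsilon> (column_matrix f ** tvar_diag a))"
proof -
  obtain \<tau> where \<tau>: "\<tau> \<in> fixed_simplices \<Gamma> Neg" "opposite Pos \<sigma> \<tau>"
    using cr \<sigma> unfolding completely_reducible_def by (metis opp.simps(1))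
  obtain f where f: "free_basis laurent f laurent_vecs"
    "\<And>v L. v \<in> \<sigma> \<Longrightarrow> L \<in> v \<Longrightarrow> \<exists>a. L = lattice_of Pos (column_matrix f ** tvar_diag a) \<and>
      (\<exists>w\<in>\<tau>. lattice_of (opp Pos) (column_matrix f ** tvar_diag a) \<in> w)"
    using opposite_common_frame[OF \<tau>(2)] by blast
  have stable: "(*v) g ` L = L"
    if "g \<in> \<Gamma>" "\<rho> \<in> fixed_simplices \<Gamma> \<epsilon>" "v \<in> \<rho>" "L \<in> v" for g \<rho> \<epsilon> v L
    using that SL_laurent_subgroupD(2)[OF \<Gamma>] unfolding fixed_simplices_def
    by (intro fixed_simplex_stabilizes_lattices[of \<rho> \<epsilon> g v L]) auto
  show ?thesis
  proof (rule that[OF f(1)])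
    fix v L assume v: "v \<in> \<sigma>" "L \<in> v"
    obtain a w where a: "L = lattice_of Pos (column_matrix f ** tvar_diag a)"
      "w \<in> \<tau>" "lattice_of Neg (column_matrix f ** tvar_diag a) \<in> w"
      using f(2)[OF v] by auto
    have "(*v) g ` lattice_of \<epsilon> (column_matrix f ** tvar_diag a) =
        lattice_of \<epsilon> (column_matrix f ** tvar_diag a)" if "g \<in> \<Gamma>" for g \<epsilon>
      using stable[OF that \<sigma> v] stable[OF that \<tau>(1) a(2,3)] a(1) by (cases \<epsilon>) simp_all
    with a(1) show "\<exists>a. L = lattice_of Pos (column_matrix f ** tvar_diag a) \<and>
      (\<forall>g\<in>\<Gamma>. \<forall>\<epsilon>. (*v) g ` lattice_of \<epsilon> (column_matrix f ** tvar_diag a) =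
        lattice_of \<epsilon> (column_matrix f ** tvar_diag a))" by blast
  qed
qed

section \<open>Invariant subspaces have invariant complements\<close>

text \<open>A basis of \<open>U\<close>, extended to the whole space, gives the columns of \<open>Q\<close>; \<open>I\<close> marks those in
  \<open>U\<close>.\<close>

lemma subspace_coordinates:
  fixes U :: "('a::field ^ 'n) set"
  assumes U: "vec.subspace U"
  obtains Q :: "'a ^ 'n ^ 'n" and I where "invertible Q" "U = (*v) Q ` {y. \<forall>i. i \<notin> I \<longrightarrow> y $ i = 0}"
proof -
  obtain B where B: "B \<subseteq> U" "vec.independent B" "U \<subseteq> vec.span B"
    by (rule vec.basis_exists[of U])
  define B' where "B' = vec.extend_basis B"
  have B': "B \<subseteq> B'" "vec.independent B'" "vec.span B' = UNIV"
    unfolding B'_def using vec.extend_basis_superset[OF B(2)] vec.independent_extend_basis[OF B(2)]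
      vec.span_extend_basis[OF B(2)] by simp_all
  have "card B' = CARD('n)"
    using vec.dim_eq_card[of B' UNIV] B'(2,3) unfolding vec_dim_card by simp
  moreover have "finite B'" using B'(2) by (rule vec.finiteI_independent)
  ultimately obtain \<phi> :: "'n \<Rightarrow> 'a ^ 'n" where \<phi>: "bij_betw \<phi> UNIV B'"
    using finite_same_card_bij[of "UNIV :: 'n set" B'] by auto
  define Q where "Q = column_matrix \<phi>"
  define I where "I = {i. \<phi> i \<in> B}"
  let ?V = "{y :: 'a ^ 'n. \<forall>i. i \<notin> I \<longrightarrow> y $ i = 0}"
  have "column i Q = \<phi> i" for i by (simp add: Q_def column_matrix_def column_def vec_eq_iff)
  then have "columns Q = range \<phi>" unfolding columns_def by auto
  then have "vec.span (columns Q) = UNIV" using \<phi> B'(3) by (simp add: bij_betw_def)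
  then have Q: "invertible Q"
    unfolding invertible_right_inverse matrix_right_invertible_span_columns .
  have "(*v) Q ` ?V \<subseteq> U"
  proof
    fix v assume "v \<in> (*v) Q ` ?V"
    then obtain y where y: "v = (\<Sum>i\<in>UNIV. y $ i *s \<phi> i)" "\<And>i. i \<notin> I \<Longrightarrow> y $ i = 0"
      by (auto simp: Q_def column_matrix_vec)
    have "y $ i *s \<phi> i \<in> U" for i
    proof (cases "i \<in> I")
      case True
      then show ?thesis using B(1) by (intro vec.subspace_scale[OF U]) (auto simp: I_def)
    next
      case False
      then show ?thesis using vec.subspace_0[OF U] by (simp add: y(2))
    qed
    then show "v \<in> U" unfolding y(1) by (intro vec.subspace_sum[OF U])
  qed
  moreover have "U \<subseteq> (*v) Q ` ?V"
  proof -
    have "vec.subspace ?V" by (rule vec.subspaceI) auto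
    then have sub: "vec.subspace ((*v) Q ` ?V)" by (rule vec.subspace_image)
    have "b \<in> (*v) Q ` ?V" if "b \<in> B" for b
    proof -
      have "b \<in> range \<phi>" using \<phi> B'(1) that unfolding bij_betw_def by auto
      then obtain i where i: "b = \<phi> i" by (rule imageE)
      have "Q *v axis i 1 = b"
        by (simp add: vec_eq_iff matrix_vector_axis i Q_def column_matrix_def)
      moreover have "axis i 1 \<in> ?V" using that i by (auto simp: axis_def I_def)
      ultimately show ?thesis by blast
    qed
    then have "vec.span B \<subseteq> (*v) Q ` ?V" by (intro vec.span_minimal sub) blast
    with B(3) show ?thesis by blast
  qed
  ultimately show ?thesis using that[OF Q, of I] by blast
qed

text \<open>Lattices between \<open>L\<close> and \<open>tL\<close> correspond to subspaces of \<open>L/tL\<close>; for \<open>L = A\<^sub>+\<^sup>n\<close> this is the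
  lattice that belongs to \<open>U\<close>.\<close>

definition reduction_preimage :: "('k::field ^ 'n) set \<Rightarrow> ('k ratfun ^ 'n) set" where
  "reduction_preimage U = {y \<in> vecs (val_ring Pos). residue_vec y \<in> U}"

text \<open>In coordinates adapted to \<open>U\<close>, having a residue in \<open>U\<close> means that the remaining coordinates are
  divisible by \<open>t\<close>.\<close>

lemma reduction_preimage_lattice:
  fixes U :: "('k::field ^ 'n) set"
  assumes U: "vec.subspace U"
  obtains B where "invertible B" "reduction_preimage U = lattice_of Pos B"
proof -
  obtain Q :: "'k ^ 'n ^ 'n" and I
    where Q: "invertible Q" "U = (*v) Q ` {y. \<forall>i. i \<notin> I \<longrightarrow> y $ i = 0}"
    using subspace_coordinates[OF U] .
  obtain Q' where Q': "Q' ** Q = mat 1" "Q ** Q' = mat 1" using Q(1) invertible_obtain by metis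
  have QQ': "const_mat Q ** const_mat Q' = mat 1"
    using Q'(2) const_mat_mult const_mat_1 by metis
  define D :: "'k ratfun ^ 'n ^ 'n" where "D = tvar_diag (\<lambda>i. if i \<in> I then 0 else 1)"
  have D: "(D *v z) $ i = (if i \<in> I then z $ i else tvar * z $ i)" for z i
    by (simp add: D_def tvar_diag_nth)
  have "invertible (const_mat Q ** D)"
    using QQ' invertible_right_inverse invertible_tvar_diag invertible_mult unfolding D_def by blast
  moreover have "reduction_preimage U = lattice_of Pos (const_mat Q ** D)"
  proof (intro equalityI subsetI)
    fix y :: "'k ratfun ^ 'n" assume y: "y \<in> reduction_preimage U"
    then obtain w where w: "residue_vec y = Q *v w" "\<And>i. i \<notin> I \<Longrightarrow> w $ i = 0"
      unfolding reduction_preimage_def Q(2) by blast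
    define x where "x = const_mat Q' *v y"
    have x: "x \<in> vecs (val_ring Pos)" using y unfolding x_def reduction_preimage_def
      by (intro matrix_vector_in_vecs is_subring_val_ring const_mat_in_mats) blast
    have "residue_vec x = w"
      using y w(1) residue_mat_vec[OF const_mat_in_mats, of y Q']
      by (simp add: x_def reduction_preimage_def matrix_cancel(1)[OF Q'(1)])
    then have "residue (x $ i) = 0" if "i \<notin> I" for i
      using w(2)[OF that] by (auto simp: residue_vec_def)
    then have "\<exists>u\<in>val_ring Pos. x $ i = tvar * u" if "i \<notin> I" for i
      using x that by (auto simp: vecs_def residue_eq_0 max_ideal_iff)
    then obtain u where u: "\<And>i. i \<notin> I \<Longrightarrow> u i \<in> val_ring Pos" "\<And>i. i \<notin> I \<Longrightarrow> x $ i = tvar * u i"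
      by metis
    define z :: "'k ratfun ^ 'n" where "z = (\<chi> i. if i \<in> I then x $ i else u i)"
    have z: "z \<in> vecs (val_ring Pos)" using x u by (simp add: z_def vecs_def)
    have "D *v z = x" using u by (simp add: vec_eq_iff D z_def)
    then have "(const_mat Q ** D) *v z = y"
      by (simp add: x_def matrix_cancel(1)[OF QQ'] flip: matrix_vector_mul_assoc)
    with z show "y \<in> lattice_of Pos (const_mat Q ** D)" unfolding lattice_of_def by blast
  next
    fix y :: "'k ratfun ^ 'n" assume "y \<in> lattice_of Pos (const_mat Q ** D)"
    then obtain z where z: "z \<in> vecs (val_ring Pos)" "y = const_mat Q *v (D *v z)"
      by (auto simp: lattice_of_def simp flip: matrix_vector_mul_assoc)
    have ideal: "tvar * z $ i \<in> max_ideal" for i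
      using z(1) unfolding max_ideal_iff vecs_def by blast
    then have Dz: "D *v z \<in> vecs (val_ring Pos)"
      using z(1) max_ideal_subset by (auto simp: vecs_def D)
    have "residue_vec y = Q *v residue_vec (D *v z)"
      using residue_mat_vec[OF const_mat_in_mats Dz, of Q] z(2) by simp
    moreover have "residue_vec (D *v z) $ i = 0" if "i \<notin> I" for i
      using that ideal[of i] by (simp add: residue_vec_def D residue_eq_0[OF max_ideal_subset])
    ultimately have "residue_vec y \<in> U" unfolding Q(2) by blast
    moreover have "y \<in> vecs (val_ring Pos)"
      unfolding z(2) by (rule matrix_vector_in_vecs[OF is_subring_val_ring const_mat_in_mats Dz])
    ultimately show "y \<in> reduction_preimage U" by (simp add: reduction_preimage_def)
  qed
  ultimately show ?thesis using that by blast
qed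

text \<open>The action of \<open>\<Gamma>\<close> in the basis \<open>P\<close>, as a set of matrices over \<open>k\<close>.\<close>

definition constant_action ::
    "('k::field ratfun ^ 'n ^ 'n) set \<Rightarrow> 'k ratfun ^ 'n ^ 'n \<Rightarrow> ('k ^ 'n ^ 'n) set" where
  "constant_action \<Gamma> P = {h. \<exists>g\<in>\<Gamma>. g ** P = P ** const_mat h}"

lemma reduction_preimage_stable:
  fixes P :: "'k::field ratfun ^ 'n ^ 'n"
  assumes \<Gamma>: "subgroup \<Gamma> SL_laurent"
    and const: "\<And>g. g \<in> \<Gamma> \<Longrightarrow> \<exists>h. g ** P = P ** const_mat h"
    and U: "invariant (constant_action \<Gamma> P) U" and g: "g \<in> \<Gamma>"
  shows "(*v) g ` (*v) P ` reduction_preimage U = (*v) P ` reduction_preimage U"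
proof (rule stable_if_subset[OF \<Gamma> _ g])
  fix g assume g: "g \<in> \<Gamma>"
  then obtain h where h: "g ** P = P ** const_mat h" using const by blast
  then have hU: "\<And>u. u \<in> U \<Longrightarrow> h *v u \<in> U"
    using U g unfolding invariant_def constant_action_def by blast
  have "const_mat h *v y \<in> reduction_preimage U" if "y \<in> reduction_preimage U" for y
    using that hU residue_mat_vec[OF const_mat_in_mats, of y h]
      matrix_vector_in_vecs[OF is_subring_val_ring const_mat_in_mats, of y Pos h]
    by (simp add: reduction_preimage_def)
  then show "(*v) g ` (*v) P ` reduction_preimage U \<subseteq> (*v) P ` reduction_preimage U"
    by (auto simp: matrix_vector_mul_assoc h) (simp flip: matrix_vector_mul_assoc)
qed

text \<open>As \<open>U\<close> is neither zero nor everything, the inclusions \<open>tL \<subset> L' \<subset> L\<close> are strict, as those of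
  a simplex must be.\<close>

lemma reduction_simplex_fixed:
  fixes P :: "'k::field ratfun ^ 'n ^ 'n"
  assumes \<Gamma>: "subgroup \<Gamma> SL_laurent"
    and P: "invertible P" and const: "\<And>g. g \<in> \<Gamma> \<Longrightarrow> \<exists>h. g ** P = P ** const_mat h"
    and U: "vec.subspace U" "invariant (constant_action \<Gamma> P) U" "U \<noteq> {0}" "U \<noteq> UNIV"
  shows "{hclass (lattice_of Pos P), hclass ((*v) P ` reduction_preimage U)} \<in> fixed_simplices \<Gamma> Pos"
proof -
  let ?L = "lattice_of Pos P" and ?L' = "(*v) P ` reduction_preimage U"
  obtain P' where P': "P' ** P = mat 1" "P ** P' = mat 1" using P invertible_obtain by metis
  have inj: "P *v x = P *v y \<longleftrightarrow> x = y" for x y using matrix_cancel(1)[OF P'(1)] by metis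
  have const_mem: "P *v const_vec v \<in> ?L' \<longleftrightarrow> v \<in> U" for v
    by (auto simp: image_iff inj reduction_preimage_def const_vec_in_vecs)
  obtain B where B: "invertible B" "reduction_preimage U = lattice_of Pos B"
    using reduction_preimage_lattice[OF U(1)] .
  have lat: "is_lattice Pos ?L" "is_lattice Pos ?L'"
    unfolding is_lattice_iff using P B invertible_mult matrix_image_lattice_of by metis+
  have "?L' \<subseteq> ?L" by (auto simp: lattice_of_def reduction_preimage_def)
  moreover obtain v where "v \<notin> U" using U(4) by blast
  then have "P *v const_vec v \<in> ?L - ?L'"
    using const_mem[of v] const_vec_in_vecs by (auto simp: lattice_of_def)
  ultimately have sub1: "?L' \<subset> ?L" by blast
  have tmem: "\<And>y i. y \<in> vecs (val_ring Pos) \<Longrightarrow> (tvar *s y) $ i \<in> max_ideal"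
    unfolding vecs_def max_ideal_iff by auto
  then have tres: "residue_vec (tvar *s y) = 0" "tvar *s y \<in> vecs (val_ring Pos)"
    if "y \<in> vecs (val_ring Pos)" for y :: "'k ratfun ^ 'n"
    using max_ideal_subset[OF tmem[OF that]] tmem[OF that]
    by (auto simp: vec_eq_iff residue_vec_def residue_eq_0 vecs_def)
  have "(*s) tvar ` ?L \<subseteq> ?L'"
    using tres vec.subspace_0[OF U(1)]
    by (auto simp: lattice_of_def reduction_preimage_def simp flip: matrix_scalar_mult)
  moreover obtain u where "u \<in> U" "u \<noteq> 0" using U(3) vec.subspace_0[OF U(1)] by blast
  then have "P *v const_vec u \<in> ?L' - (*s) tvar ` ?L"
    using const_mem[of u] tres(1)
    by (auto simp: lattice_of_def inj simp flip: matrix_scalar_mult) (metis residue_const_vec)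
  ultimately have sub2: "(*s) tvar ` ?L \<subset> ?L'" by blast
  have "{hclass ?L, hclass ?L'} \<in> simplices Pos"
    unfolding simplices_def
  proof (intro CollectI exI conjI)
    let ?M = "\<lambda>i::nat. if i = 0 then ?L else ?L'"
    show "\<forall>i\<le>1. is_lattice Pos (?M i)" "\<forall>i<1. ?M (Suc i) \<subset> ?M i"
      "(*s) (uniformizer Pos) ` ?M 0 \<subset> ?M 1"
      using lat sub1 sub2 by simp_all
    have "{..1::nat} = {0, 1}" by auto
    then show "{hclass ?L, hclass ?L'} = (\<lambda>i. hclass (?M i)) ` {..1}" by simp
  qed
  moreover have "act_simplex g {hclass ?L, hclass ?L'} = {hclass ?L, hclass ?L'}" if "g \<in> \<Gamma>" for g
  proof -
    have "?L = (*v) P ` reduction_preimage UNIV" by (simp add: lattice_of_def reduction_preimage_def)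
    then have "(*v) g ` ?L = ?L"
      using reduction_preimage_stable[OF \<Gamma> const _ that, of UNIV] by (simp add: invariant_def)
    moreover have "(*v) g ` ?L' = ?L'" by (rule reduction_preimage_stable[OF \<Gamma> const U(2) that])
    ultimately show ?thesis unfolding act_simplex_def by (simp add: hclass_matrix_image)
  qed
  ultimately show ?thesis by (simp add: fixed_simplices_def)
qed

definition coord_projection :: "'n set \<Rightarrow> 'a::field ^ 'n ^ 'n" where
  "coord_projection J = (\<chi> i j. if i = j \<and> i \<in> J then 1 else 0)"

lemma coord_projection_nth: "(coord_projection J *v y) $ i = (if i \<in> J then y $ i else 0)"
  by (cases "i \<in> J") (simp_all add: coord_projection_def matrix_vector_mult_def
      if_distrib[of "\<lambda>x. x * _"] cong: if_cong)

lemma matrix_mult_diag_right: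
  "(h ** (\<chi> i j. if i = j then d i else 0)) $ i $ j = h $ i $ j * (d j :: 'a::field)"
  by (simp add: matrix_matrix_mult_def if_distrib[of "\<lambda>x. _ * x"] cong: if_cong)

lemma matrix_mult_diag_left:
  "((\<chi> i j. if i = j then d i else 0) ** h) $ i $ j = (d i :: 'a::field) * h $ i $ j"
  by (simp add: matrix_matrix_mult_def if_distrib[of "\<lambda>x. x * _"] cong: if_cong)

lemma coord_projection_diag: "coord_projection J = (\<chi> i j. if i = j then if i \<in> J then 1 else 0 else 0)"
  by (simp add: coord_projection_def vec_eq_iff)

text \<open>Let \<open>L' \<subset> L\<close> be the fixed edge belonging to \<open>U\<close>. A fixed opposite edge gives exponents \<open>a\<close> and
  \<open>b\<close> for one \<open>R\<close>-basis, so that \<open>T = F t\<^sup>a\<close> spans \<open>L\<close> and \<open>T t\<^sup>c\<close> with \<open>c = b - a\<close> spans \<open>L'\<close>, and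
  \<open>\<Gamma>\<close> acts by constant matrices in both bases. An entry \<open>(i, j)\<close> in the two descriptions differs
  by the factor \<open>t\<close> to the power \<open>c\<^sub>j - c\<^sub>i\<close>, and both versions are constant, so the entry
  vanishes unless \<open>c\<^sub>i = c\<^sub>j\<close>. Therefore the projection onto the coordinates with \<open>c\<^sub>i = 0\<close> commutes
  with \<open>\<Gamma>\<close>. The residue \<open>C\<^sub>0\<close> of the base change from \<open>P\<close> to \<open>T\<close> carries these coordinates onto
  \<open>U\<close>, because \<open>L'\<close> has image \<open>U\<close> in \<open>L/tL\<close>.\<close>

lemma invariant_subspace_projection:
  fixes P :: "'k::field ratfun ^ 'n ^ 'n"
  assumes \<Gamma>: "subgroup \<Gamma> SL_laurent" and cr: "completely_reducible \<Gamma>"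
    and P: "invertible P" and const: "\<And>g. g \<in> \<Gamma> \<Longrightarrow> \<exists>h. g ** P = P ** const_mat h"
    and U: "vec.subspace U" "invariant (constant_action \<Gamma> P) U" "U \<noteq> {0}" "U \<noteq> UNIV"
  obtains p where "p ** p = p" "range ((*v) p) = U" "\<And>h. h \<in> constant_action \<Gamma> P \<Longrightarrow> p ** h = h ** p"
proof -
  let ?A = "val_ring Pos :: 'k ratfun set"
  let ?L = "lattice_of Pos P" and ?L' = "(*v) P ` reduction_preimage U"
  obtain P' where P': "P' ** P = mat 1" "P ** P' = mat 1" using P invertible_obtain by metis
  have \<sigma>: "{hclass ?L, hclass ?L'} \<in> fixed_simplices \<Gamma> Pos"
    by (rule reduction_simplex_fixed[OF \<Gamma> P const U])
  obtain f where f: "free_basis laurent f laurent_vecs"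
    "\<And>v L. v \<in> {hclass ?L, hclass ?L'} \<Longrightarrow> L \<in> v \<Longrightarrow>
      \<exists>a. L = lattice_of Pos (column_matrix f ** tvar_diag a) \<and>
      (\<forall>g\<in>\<Gamma>. \<forall>\<epsilon>. (*v) g ` lattice_of \<epsilon> (column_matrix f ** tvar_diag a) =
        lattice_of \<epsilon> (column_matrix f ** tvar_diag a))"
    by (rule fixed_simplex_common_frame[OF \<Gamma> cr \<sigma>]) (rule that)
  let ?F = "\<lambda>a. column_matrix f ** tvar_diag a"
  have frame: "laurent_frame (?F a)" for a
    using laurent_frame_mult[OF laurent_frame_column_matrix[OF f(1)] laurent_frame_tvar_diag] .
  have "?L \<in> hclass ?L" "?L' \<in> hclass ?L'" by (rule hclass_self)+
  note f2 = f(2)[OF insertI1 this(1)] f(2)[OF insertI2[OF insertI1] this(2)]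
  from f2(1) obtain a where a: "?L = lattice_of Pos (?F a)"
      "\<And>g \<epsilon>. g \<in> \<Gamma> \<Longrightarrow> (*v) g ` lattice_of \<epsilon> (?F a) = lattice_of \<epsilon> (?F a)"
    by (elim exE conjE) (rule that, assumption, blast)
  from f2(2) obtain b where b: "?L' = lattice_of Pos (?F b)"
      "\<And>g \<epsilon>. g \<in> \<Gamma> \<Longrightarrow> (*v) g ` lattice_of \<epsilon> (?F b) = lattice_of \<epsilon> (?F b)"
    by (elim exE conjE) (rule that, assumption, blast)
  define c where "c i = b i - a i" for i
  define T where "T = ?F a"
  define D :: "'k ratfun ^ 'n ^ 'n" where "D = tvar_diag c"
  have Fb: "?F b = T ** D"
    by (simp add: T_def D_def c_def tvar_diag_mult flip: matrix_mul_assoc)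
  obtain T' where T': "T' ** T = mat 1" "T ** T' = mat 1"
    using frame[of a] invertible_obtain unfolding laurent_frame_def T_def by metis

  \<comment> \<open>The exponents of the smaller lattice are at least those of the larger one.\<close>
  have "?L' \<subseteq> ?L" by (auto simp: lattice_of_def reduction_preimage_def)
  then have "D \<in> mats ?A"
    using lattice_of_subset_iff[OF T'(1), of Pos "T ** D"] matrix_cancel(2)[OF T'(1), of D]
    unfolding a(1) b(1) Fb T_def[symmetric] by simp
  then have "D $ i $ i \<in> ?A" for i by (simp add: mats_def)
  then have "tvar powi c i \<in> ?A" for i by (simp add: D_def tvar_diag_def)
  then have c: "0 \<le> c i" for i by (simp add: val_ring_def val_power_int val_tvar)

  define J where "J = {i. c i = 0}"
  define E :: "'k ^ 'n ^ 'n" where "E = coord_projection J"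
  have block: "\<exists>h. g ** T = T ** const_mat h \<and> h ** E = E ** h" if g: "g \<in> \<Gamma>" for g
  proof -
    obtain h where h: "g ** T = T ** const_mat h"
      using frame_action_const[OF frame SL_laurent_subgroupD(1)[OF \<Gamma> g] a(2)[OF g]]
      unfolding T_def by metis
    obtain k where k: "g ** (T ** D) = (T ** D) ** const_mat k"
      using frame_action_const[OF frame SL_laurent_subgroupD(1)[OF \<Gamma> g] b(2)[OF g]]
      unfolding Fb by metis
    have "T ** (const_mat h ** D) = T ** (D ** const_mat k)"
      using h k by (simp add: matrix_mul_assoc)
    then have hk: "const_mat h ** D = D ** const_mat k" using matrix_cancel(2)[OF T'(1)] by metis
    have "c i = c j" if "h $ i $ j \<noteq> 0" for i j
    proof -
      have eq: "const (h $ i $ j) * tvar powi c j = tvar powi c i * const (k $ i $ j)"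
        using arg_cong[OF hk, of "\<lambda>X. X $ i $ j"]
        by (simp add: D_def tvar_diag_def matrix_mult_diag_left matrix_mult_diag_right)
      then have "k $ i $ j \<noteq> 0" using that by auto
      then show ?thesis
        using arg_cong[OF eq, of "val Pos"] that by (simp add: val_mult val_const val_power_int val_tvar)
    qed
    then have "h $ i $ j = 0 \<or> (i \<in> J \<longleftrightarrow> j \<in> J)" for i j unfolding J_def by fastforce
    then have "h ** E = E ** h"
      by (fastforce simp: vec_eq_iff E_def coord_projection_diag matrix_mult_diag_left matrix_mult_diag_right)
    with h show ?thesis by blast
  qed

  \<comment> \<open>Both \<open>P\<close> and \<open>T\<close> span \<open>L\<close>, so the base change is invertible over the valuation ring.\<close>
  define C where "C = P' ** T"
  define C' where "C' = T' ** P"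
  have C: "C \<in> mats ?A" "C' \<in> mats ?A"
    unfolding C_def C'_def lattice_of_subset_iff[OF P'(1), symmetric] lattice_of_subset_iff[OF T'(1), symmetric]
    using a(1) by (simp_all add: T_def)
  have CC': "C ** C' = mat 1" "T = P ** C"
    using T'(2) P'(1) by (simp_all add: C_def C'_def matrix_cancel(2)[OF P'(2)] matrix_cancel(2)[OF T'(2)] flip: matrix_mul_assoc)
  define C0 where "C0 = residue_mat C"
  define C0' where "C0' = residue_mat C'"
  have C0: "C0 ** C0' = mat 1"
    unfolding C0_def C0'_def using residue_mat_mult[OF C] CC'(1) by simp
  then have C0': "C0' ** C0 = mat 1" using matrix_left_right_inverse by blast
  have EE: "E ** E = E"
    by (simp add: matrix_eq vec_eq_iff coord_projection_nth E_def flip: matrix_vector_mul_assoc)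
  define p where "p = C0 ** E ** C0'"
  have "p ** p = C0 ** (E ** (C0' ** C0) ** E) ** C0'" by (simp only: p_def matrix_mul_assoc)
  then have pp: "p ** p = p" by (simp add: C0' EE p_def)
  have comm: "p ** h = h ** p" if "h \<in> constant_action \<Gamma> P" for h
  proof -
    from that obtain g where g: "g \<in> \<Gamma>" "g ** P = P ** const_mat h"
      by (auto simp: constant_action_def)
    from block[OF g(1)] obtain k where k: "g ** T = T ** const_mat k" "k ** E = E ** k" by auto
    have "P ** (const_mat h ** C) = P ** (C ** const_mat k)"
      using g(2) k(1) unfolding CC'(2) by (simp add: matrix_mul_assoc)
    then have "const_mat h ** C = C ** const_mat k" using matrix_cancel(2)[OF P'(1)] by metis
    then have "residue_mat (const_mat h ** C) = residue_mat (C ** const_mat k)" by simp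
    then have hC0: "h ** C0 = C0 ** k"
      unfolding residue_mat_mult[OF const_mat_in_mats C(1)] residue_mat_mult[OF C(1) const_mat_in_mats]
      by (simp add: C0_def)
    have "C0' ** h = C0' ** (h ** C0) ** C0'" using C0 by (simp flip: matrix_mul_assoc)
    also have "\<dots> = k ** C0'" unfolding hC0 by (simp add: matrix_cancel(2)[OF C0'])
    finally have "p ** h = C0 ** (E ** k) ** C0'" by (simp add: p_def flip: matrix_mul_assoc)
    also have "\<dots> = (C0 ** k) ** E ** C0'" by (simp flip: k(2)) (simp add: matrix_mul_assoc)
    also have "\<dots> = h ** p" by (simp flip: hC0) (simp add: p_def matrix_mul_assoc)
    finally show ?thesis .
  qed
  have range: "range ((*v) p) = U"
  proof (intro equalityI subsetI)
    fix u assume "u \<in> range ((*v) p)"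
    then obtain w where w: "u = C0 *v (E *v w)"
      by (auto simp: p_def simp flip: matrix_vector_mul_assoc)
    \<comment> \<open>The factor \<open>t\<^sup>c\<close> fixes constant vectors supported where \<open>c\<close> vanishes.\<close>
    let ?y = "const_vec (E *v w)"
    have "D *v ?y = ?y"
      by (simp add: vec_eq_iff D_def tvar_diag_nth const_vec_def E_def coord_projection_nth J_def)
    then have "P *v (C *v ?y) = (T ** D) *v ?y"
      by (simp add: CC'(2) flip: matrix_vector_mul_assoc)
    then have "P *v (C *v ?y) \<in> ?L'"
      unfolding b(1) Fb lattice_of_def using const_vec_in_vecs by blast
    then have "C *v ?y \<in> reduction_preimage U" using matrix_cancel(1)[OF P'(1)] by (metis imageE)
    then have "residue_vec (C *v ?y) \<in> U" by (simp add: reduction_preimage_def)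
    then show "u \<in> U"
      using residue_mat_vec[OF C(1) const_vec_in_vecs] w by (simp add: C0_def)
  next
    fix u assume "u \<in> U"
    then have "P *v const_vec u \<in> ?L'" by (simp add: reduction_preimage_def const_vec_in_vecs)
    then obtain z where z: "z \<in> vecs ?A" "P *v const_vec u = P *v (C *v (D *v z))"
      unfolding b(1) Fb lattice_of_def CC'(2) by (auto simp flip: matrix_vector_mul_assoc)
    then have u: "const_vec u = C *v (D *v z)" using matrix_cancel(1)[OF P'(1)] by metis
    let ?w = "residue_vec (D *v z)"
    have Dz: "D *v z \<in> vecs ?A"
      using z(1) \<open>D \<in> mats ?A\<close> by (intro matrix_vector_in_vecs is_subring_val_ring)
    \<comment> \<open>Outside \<open>J\<close> the exponents are positive, so reduction kills these coordinates.\<close>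
    have "?w $ i = 0" if "i \<notin> J" for i
    proof -
      have "tvar powi c i \<in> max_ideal"
        using that c[of i] by (simp add: max_ideal_def val_power_int val_tvar J_def)
      then have "(D *v z) $ i \<in> max_ideal"
        using max_ideal_mult[of "tvar powi c i" "z $ i"] z(1) by (simp add: D_def tvar_diag_nth vecs_def)
      then show ?thesis by (simp add: residue_vec_def residue_eq_0 max_ideal_subset)
    qed
    then have "E *v ?w = ?w" by (simp add: vec_eq_iff E_def coord_projection_nth)
    then have "p *v (C0 *v ?w) = C0 *v ?w"
      by (simp add: p_def matrix_cancel(1)[OF C0'] flip: matrix_vector_mul_assoc)
    moreover have "u = C0 *v ?w"
      using arg_cong[OF u, of residue_vec] residue_mat_vec[OF C(1) Dz] by (simp add: C0_def)
    ultimately show "u \<in> range ((*v) p)" by (metis rangeI)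
  qed
  show ?thesis using that pp comm range by blast
qed


section \<open>Orthogonal idempotents with irreducible images\<close>

lemma matrix_sum_mult_left: "(\<Sum>p\<in>S. f p) ** q = (\<Sum>p\<in>S. f p ** (q :: 'a::comm_ring_1 ^ 'n ^ 'n))"
  by (simp add: vec_eq_iff matrix_matrix_mult_def sum_distrib_right) (intro allI sum.swap)

lemma matrix_sum_mult_right: "q ** (\<Sum>p\<in>S. f p) = (\<Sum>p\<in>S. (q :: 'a::comm_ring_1 ^ 'n ^ 'n) ** f p)"
  by (simp add: vec_eq_iff matrix_matrix_mult_def sum_distrib_left) (intro allI sum.swap)

lemma range_subset_idempotent_iff:
  fixes e q :: "'a::field ^ 'n ^ 'n"
  assumes "e ** e = e"
  shows "range ((*v) q) \<subseteq> range ((*v) e) \<longleftrightarrow> e ** q = q"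
proof
  assume sub: "range ((*v) q) \<subseteq> range ((*v) e)"
  have "e *v (q *v x) = q *v x" for x
  proof -
    obtain y where "q *v x = e *v y" using sub by blast
    then show ?thesis by (simp add: matrix_vector_mul_assoc assms)
  qed
  then show "e ** q = q" by (simp add: matrix_eq flip: matrix_vector_mul_assoc)
next
  assume "e ** q = q"
  then have "q *v x = e *v (q *v x)" for x by (simp add: matrix_vector_mul_assoc)
  then show "range ((*v) q) \<subseteq> range ((*v) e)" by blast
qed

lemma invariant_range:
  assumes "\<And>h. h \<in> \<Delta> \<Longrightarrow> p ** h = h ** p"
  shows "invariant \<Delta> (range ((*v) p))"
  unfolding invariant_def
proof safe
  fix h x assume "h \<in> \<Delta>"
  then have "h *v (p *v x) = p *v (h *v x)" by (simp add: matrix_vector_mul_assoc assms)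
  then show "h *v (p *v x) \<in> range ((*v) p)" by simp
qed

text \<open>Induction on the rank of \<open>e\<close>. Idempotents are used in place of subspaces because they carry over
  to \<open>R\<^sup>n\<close> and \<open>K\<^sup>n\<close> without change. If the image of \<open>e\<close> is reducible, a projection \<open>p\<close> onto a
  proper invariant part of it splits \<open>e\<close> into the orthogonal idempotents \<open>p e\<close> and \<open>e - p e\<close>, both
  of smaller rank.\<close>

lemma irreducible_idempotents:
  fixes \<Delta> :: "('a::field ^ 'n ^ 'n) set" and e :: "'a ^ 'n ^ 'n"
  assumes complements: "\<And>U. vec.subspace U \<Longrightarrow> invariant \<Delta> U \<Longrightarrow>
      \<exists>p. p ** p = p \<and> range ((*v) p) = U \<and> (\<forall>h\<in>\<Delta>. p ** h = h ** p)"
    and e: "e ** e = e" "\<And>h. h \<in> \<Delta> \<Longrightarrow> e ** h = h ** e"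
  shows "\<exists>S. finite S \<and> e = \<Sum>S \<and>
      (\<forall>p\<in>S. p ** p = p \<and> (\<forall>h\<in>\<Delta>. p ** h = h ** p) \<and> irreducible_rep \<Delta> (range ((*v) p))) \<and>
      (\<forall>p\<in>S. \<forall>q\<in>S. p \<noteq> q \<longrightarrow> p ** q = 0)"
  using e
proof (induction "vec.dim (range ((*v) e))" arbitrary: e rule: less_induct)
  case (less e)
  note ee = less.prems(1) and comm = less.prems(2)
  let ?W = "range ((*v) e)"
  have W: "vec.subspace ?W" "invariant \<Delta> ?W"
    by (auto intro: vec.subspace_image vec.subspace_UNIV invariant_range comm)
  consider "e = 0" | "irreducible_rep \<Delta> ?W" | "e \<noteq> 0" "\<not> irreducible_rep \<Delta> ?W" by blast
  then show ?case
  proof cases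
    case 1
    then show ?thesis by (intro exI[of _ "{}"]) simp
  next
    case 2
    then show ?thesis using ee comm by (intro exI[of _ "{e}"]) simp
  next
    case 3
    have "?W \<noteq> {0}" using 3(1) by (auto simp: matrix_eq)
    with 3(2) W obtain U where U: "vec.subspace U" "U \<subseteq> ?W" "invariant \<Delta> U" "U \<noteq> {0}" "U \<noteq> ?W"
      unfolding irreducible_rep_def by blast
    obtain p where p: "p ** p = p" "range ((*v) p) = U" "\<And>h. h \<in> \<Delta> \<Longrightarrow> p ** h = h ** p"
      using complements[OF U(1,3)] by blast
    have ep: "e ** p = p" using range_subset_idempotent_iff[OF ee] U(2) p(2) by blast
    define p1 where "p1 = p ** e"
    define p2 where "p2 = e - p1"
    have "p ** e ** (p ** e) = p ** (e ** p) ** e" by (simp only: matrix_mul_assoc)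
    then have idem1: "p1 ** p1 = p1" by (simp add: p1_def ep p(1))
    have ep1: "e ** p1 = p1" by (simp add: p1_def ep matrix_mul_assoc)
    have p1e: "p1 ** e = p1" by (simp add: p1_def ee flip: matrix_mul_assoc)
    have sub_left: "(x - y) ** z = x ** z - y ** z" for x y z :: "'a ^ 'n ^ 'n"
      by (simp add: vec_eq_iff matrix_matrix_mult_def algebra_simps sum_subtractf)
    have sub_right: "z ** (x - y) = z ** x - z ** y" for x y z :: "'a ^ 'n ^ 'n"
      by (simp add: vec_eq_iff matrix_matrix_mult_def algebra_simps sum_subtractf)
    have idem2: "p2 ** p2 = p2" and p12: "p1 ** p2 = 0" and p21: "p2 ** p1 = 0"
      and ep2: "e ** p2 = p2"
      by (simp_all add: p2_def sub_left sub_right ee ep1 p1e idem1)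
    have comm1: "p1 ** h = h ** p1" if "h \<in> \<Delta>" for h
      unfolding p1_def using comm[OF that] p(3)[OF that] by (metis matrix_mul_assoc)
    have comm2: "p2 ** h = h ** p2" if "h \<in> \<Delta>" for h
      by (simp add: p2_def sub_left sub_right comm[OF that] comm1[OF that])
    have sub: "range ((*v) p1) \<subseteq> ?W" "range ((*v) p2) \<subseteq> ?W"
      using range_subset_idempotent_iff[OF ee] ep1 ep2 by blast+
    have p1U: "p1 *v u = u" if "u \<in> U" for u
    proof -
      from that obtain x where "u = p *v x" unfolding p(2)[symmetric] by blast
      then have "p1 *v u = p *v ((e ** p) *v x)" by (simp add: p1_def matrix_vector_mul_assoc matrix_mul_assoc)
      then show ?thesis using \<open>u = p *v x\<close> by (simp add: ep matrix_vector_mul_assoc p(1))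
    qed
    have "range ((*v) p1) \<subseteq> U" unfolding p1_def using p(2) by (auto simp flip: matrix_vector_mul_assoc)
    then have ne1: "range ((*v) p1) \<noteq> ?W" using U(2,5) by blast
    have ne2: "range ((*v) p2) \<noteq> ?W"
    proof
      assume eq: "range ((*v) p2) = ?W"
      obtain u where u: "u \<in> U" "u \<noteq> 0" using U(4) vec.subspace_0[OF U(1)] by blast
      then obtain x where x: "u = p2 *v x" using U(2) eq by blast
      have "u = p1 *v u" using p1U u(1) by simp
      also have "\<dots> = 0" by (simp add: x matrix_vector_mul_assoc p12)
      finally show False using u(2) by simp
    qed
    have smaller: "vec.dim (range ((*v) q)) < vec.dim ?W"
      if "range ((*v) q) \<subseteq> ?W" "range ((*v) q) \<noteq> ?W" for q :: "'a ^ 'n ^ 'n"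
    proof -
      have "vec.subspace (range ((*v) q))" by (intro vec.subspace_image vec.subspace_UNIV)
      then show ?thesis
        using that W(1) vec.subspace_dim_equal[of "range ((*v) q)" ?W] vec.dim_subset[OF that(1)]
        by linarith
    qed
    have "\<exists>S. finite S \<and> p1 = \<Sum>S \<and>
        (\<forall>p\<in>S. p ** p = p \<and> (\<forall>h\<in>\<Delta>. p ** h = h ** p) \<and> irreducible_rep \<Delta> (range ((*v) p))) \<and>
        (\<forall>p\<in>S. \<forall>q\<in>S. p \<noteq> q \<longrightarrow> p ** q = 0)"
      by (rule less.hyps[OF smaller[OF sub(1) ne1] idem1]) (rule comm1)
    then obtain S1 where S1: "finite S1" "p1 = \<Sum>S1"
      "\<And>q. q \<in> S1 \<Longrightarrow> q ** q = q \<and> (\<forall>h\<in>\<Delta>. q ** h = h ** q) \<and> irreducible_rep \<Delta> (range ((*v) q))"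
      "\<And>q q'. q \<in> S1 \<Longrightarrow> q' \<in> S1 \<Longrightarrow> q \<noteq> q' \<Longrightarrow> q ** q' = 0"
      by (elim exE conjE) (rule that, assumption, assumption, blast+)
    have "\<exists>S. finite S \<and> p2 = \<Sum>S \<and>
        (\<forall>p\<in>S. p ** p = p \<and> (\<forall>h\<in>\<Delta>. p ** h = h ** p) \<and> irreducible_rep \<Delta> (range ((*v) p))) \<and>
        (\<forall>p\<in>S. \<forall>q\<in>S. p \<noteq> q \<longrightarrow> p ** q = 0)"
      by (rule less.hyps[OF smaller[OF sub(2) ne2] idem2]) (rule comm2)
    then obtain S2 where S2: "finite S2" "p2 = \<Sum>S2"
      "\<And>q. q \<in> S2 \<Longrightarrow> q ** q = q \<and> (\<forall>h\<in>\<Delta>. q ** h = h ** q) \<and> irreducible_rep \<Delta> (range ((*v) q))"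
      "\<And>q q'. q \<in> S2 \<Longrightarrow> q' \<in> S2 \<Longrightarrow> q \<noteq> q' \<Longrightarrow> q ** q' = 0"
      by (elim exE conjE) (rule that, assumption, assumption, blast+)
    have absorb: "q ** \<Sum>S = q" "\<Sum>S ** q = q"
      if "finite S" "q \<in> S" "q ** q = q" "\<And>q'. q' \<in> S \<Longrightarrow> q \<noteq> q' \<Longrightarrow> q ** q' = 0 \<and> q' ** q = 0"
      for S and q :: "'a ^ 'n ^ 'n"
    proof -
      have "q ** \<Sum>S = (\<Sum>q'\<in>S. if q' = q then q else 0)"
        unfolding matrix_sum_mult_right using that(3,4) by (intro sum.cong) auto
      then show "q ** \<Sum>S = q" using that(1,2) by simp
      have "\<Sum>S ** q = (\<Sum>q'\<in>S. if q' = q then q else 0)"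
        unfolding matrix_sum_mult_left using that(3,4) by (intro sum.cong) auto
      then show "\<Sum>S ** q = q" using that(1,2) by simp
    qed
    \<comment> \<open>Each \<open>q\<close> in \<open>S1\<close> is absorbed by \<open>p1\<close>, each \<open>q'\<close> in \<open>S2\<close> by \<open>p2\<close>, and these are orthogonal.\<close>
    have cross: "q ** q' = 0" "q' ** q = 0" if "q \<in> S1" "q' \<in> S2" for q q'
    proof -
      have a1: "q ** p1 = q" "p1 ** q = q"
        unfolding S1(2) using absorb[OF S1(1) that(1)] S1(3,4) that(1) by blast+
      have a2: "q' ** p2 = q'" "p2 ** q' = q'"
        unfolding S2(2) using absorb[OF S2(1) that(2)] S2(3,4) that(2) by blast+
      have "q ** q' = q ** (p1 ** p2) ** q'" using a1(1) a2(2) by (metis matrix_mul_assoc)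
      then show "q ** q' = 0" by (simp add: p12)
      have "q' ** q = q' ** (p2 ** p1) ** q" using a1(2) a2(1) by (metis matrix_mul_assoc)
      then show "q' ** q = 0" by (simp add: p21)
    qed
    have "q \<noteq> 0" if "q \<in> S1" for q
      using S1(3)[OF that] by (auto simp: irreducible_rep_def image_constant_conv)
    then have disj: "S1 \<inter> S2 = {}" using cross(1) S1(3) by fastforce
    have "e = p1 + p2" by (simp add: p2_def)
    then have "e = \<Sum>(S1 \<union> S2)"
      using sum.union_disjoint[OF S1(1) S2(1) disj, of "\<lambda>x. x"] S1(2) S2(2) by simp
    then show ?thesis using S1 S2 cross by (intro exI[of _ "S1 \<union> S2"]) (simp, blast)
  qed
qed

section \<open>Irreducibility over the function field\<close>

text \<open>Let \<open>W\<close> be a nonzero invariant \<open>K\<close>-subspace of the image, in coordinates of \<open>P\<close>. The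
  residues of its vectors over the valuation ring form a nonzero invariant subspace \<open>W\<^sub>0\<close> of the
  image of \<open>p\<close>, hence all of it. Lifting the columns of \<open>p\<close> to vectors of \<open>W\<close> gives a matrix \<open>M\<close>
  with \<open>M = p N\<close>, where \<open>N = 1 + (M - p)\<close> reduces to the identity modulo \<open>t\<close> and is therefore
  invertible over \<open>K\<close>. So the image of \<open>p\<close> over \<open>K\<close> equals that of \<open>M\<close>, which lies in \<open>W\<close>.\<close>

lemma irreducible_after_scalar_extension:
  fixes P :: "'k::field ratfun ^ 'n ^ 'n"
  assumes P: "invertible P" and const: "\<And>g. g \<in> \<Gamma> \<Longrightarrow> \<exists>h. g ** P = P ** const_mat h"
    and p: "p ** p = p" "\<And>h. h \<in> constant_action \<Gamma> P \<Longrightarrow> p ** h = h ** p"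
      "irreducible_rep (constant_action \<Gamma> P) (range ((*v) p))"
  shows "irreducible_rep \<Gamma> (range ((*v) (P ** const_mat p)))"
proof -
  let ?A = "val_ring Pos :: 'k ratfun set"
  let ?e = "const_mat p" and ?V = "range ((*v) (P ** const_mat p))"
  obtain P' where P': "P' ** P = mat 1" using P invertible_obtain by metis
  have inj: "x = y" if "P *v x = P *v y" for x y using matrix_cancel(1)[OF P'] that by metis
  have ee: "?e ** ?e = ?e" using p(1) const_mat_mult by metis
  have sub: "vec.subspace ?V" by (intro vec.subspace_image vec.subspace_UNIV)
  have inv: "invariant \<Gamma> ?V"
    unfolding invariant_def
  proof safe
    fix g x assume g: "g \<in> \<Gamma>"
    then obtain h where h: "g ** P = P ** const_mat h" using const by blast
    then have "p ** h = h ** p" using p(2) g unfolding constant_action_def by blast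
    then have "const_mat h ** ?e = ?e ** const_mat h" by (metis const_mat_mult)
    then have "g *v ((P ** ?e) *v x) = (P ** ?e) *v (const_mat h *v x)"
      by (metis h matrix_mul_assoc matrix_vector_mul_assoc)
    then show "g *v ((P ** ?e) *v x) \<in> ?V" by simp
  qed
  have "range ((*v) p) \<noteq> {0}" using p(3) by (simp add: irreducible_rep_def)
  moreover have "range ((*v) p) = {0}" if "\<And>x. p *v x = 0" using that by auto
  ultimately obtain x where x: "p *v x \<noteq> 0" by blast
  have nonzero: "?V \<noteq> {0}"
  proof
    assume "?V = {0}"
    then have "(P ** ?e) *v const_vec x = 0" by blast
    then have "P *v const_vec (p *v x) = P *v 0" by (simp add: const_mat_vec flip: matrix_vector_mul_assoc)
    then have "const_vec (p *v x) = 0" by (rule inj)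
    then have "residue_vec (const_vec (p *v x)) = 0" by (simp add: residue_vec_def vec_eq_iff)
    with x show False by simp
  qed
  have "W = ?V" if W: "vec.subspace W" "W \<subseteq> ?V" "invariant \<Gamma> W" "W \<noteq> {0}" for W
  proof -
    define W' where "W' = {y. P *v y \<in> W}"
    have W': "vec.subspace W'"
      unfolding W'_def using W(1) by (intro vec.subspaceI)
        (auto simp: vec.subspace_def matrix_vector_right_distrib matrix_scalar_mult)
    have eW: "?e *v y = y" if "y \<in> W'" for y
    proof -
      have "P *v y \<in> ?V" using that W(2) unfolding W'_def by blast
      then obtain z where "P *v y = P *v (?e *v z)"
        by (auto simp flip: matrix_vector_mul_assoc)
      then have "y = ?e *v z" by (rule inj)
      then show ?thesis by (simp add: matrix_vector_mul_assoc ee)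
    qed
    define W0 where "W0 = residue_vec ` (W' \<inter> vecs ?A)"
    have add: "residue_vec (x + y) = residue_vec x + residue_vec y" "x + y \<in> vecs ?A"
      if "x \<in> vecs ?A" "y \<in> vecs ?A" for x y :: "'k ratfun ^ 'n"
      using that
      by (simp_all add: residue_vec_def vecs_def vec_eq_iff residue_add subring_closed[OF is_subring_val_ring])
    have scale: "residue_vec (const c *s y) = c *s residue_vec y" "const c *s y \<in> vecs ?A"
      if "y \<in> vecs ?A" for c and y :: "'k ratfun ^ 'n"
      using that
      by (simp_all add: residue_vec_def vecs_def vec_eq_iff residue_mult const_in_val_ring
          subring_closed[OF is_subring_val_ring])
    have "vec.subspace W0"
    proof (rule vec.subspaceI)
      have "(0 :: 'k ratfun ^ 'n) \<in> W' \<inter> vecs ?A" "residue_vec (0 :: 'k ratfun ^ 'n) = 0"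
        using vec.subspace_0[OF W'] by (auto simp: vecs_def val_ring_def residue_vec_def vec_eq_iff)
      then show "0 \<in> W0" unfolding W0_def by (metis imageI)
    next
      fix x y assume "x \<in> W0" "y \<in> W0"
      then obtain x' y' where xy: "x = residue_vec x'" "y = residue_vec y'"
        "x' \<in> W'" "y' \<in> W'" "x' \<in> vecs ?A" "y' \<in> vecs ?A" unfolding W0_def by blast
      then have "x + y = residue_vec (x' + y')" "x' + y' \<in> W' \<inter> vecs ?A"
        using add vec.subspace_add[OF W'] by auto
      then show "x + y \<in> W0" unfolding W0_def by blast
    next
      fix c x assume "x \<in> W0"
      then obtain x' where x: "x = residue_vec x'" "x' \<in> W'" "x' \<in> vecs ?A" unfolding W0_def by blast
      then have "c *s x = residue_vec (const c *s x')" "const c *s x' \<in> W' \<inter> vecs ?A"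
        using scale vec.subspace_scale[OF W'] by auto
      then show "c *s x \<in> W0" unfolding W0_def by blast
    qed
    moreover have "W0 \<subseteq> range ((*v) p)"
    proof
      fix x assume "x \<in> W0"
      then obtain y where y: "x = residue_vec y" "y \<in> W'" "y \<in> vecs ?A" unfolding W0_def by blast
      then have "x = p *v x"
        using residue_mat_vec[OF const_mat_in_mats y(3), of p] eW[OF y(2)] by simp
      then show "x \<in> range ((*v) p)" by blast
    qed
    moreover have "invariant (constant_action \<Gamma> P) W0"
      unfolding invariant_def
    proof (intro ballI)
      fix h x assume "h \<in> constant_action \<Gamma> P" "x \<in> W0"
      then obtain g y where h: "g \<in> \<Gamma>" "g ** P = P ** const_mat h"
        and y: "x = residue_vec y" "y \<in> W'" "y \<in> vecs ?A" unfolding W0_def constant_action_def by blast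
      have "g *v (P *v y) \<in> W" using W(3) h(1) y(2) unfolding invariant_def W'_def by blast
      then have "const_mat h *v y \<in> W'" by (simp add: W'_def matrix_vector_mul_assoc h(2))
      moreover have "h *v x = residue_vec (const_mat h *v y)"
        using residue_mat_vec[OF const_mat_in_mats y(3), of h] y(1) by simp
      ultimately show "h *v x \<in> W0"
        unfolding W0_def using matrix_vector_in_vecs[OF is_subring_val_ring const_mat_in_mats y(3)] by blast
    qed
    moreover have "W0 \<noteq> {0}"
    proof -
      obtain w where "w \<in> W" "w \<noteq> 0" using W(4) vec.subspace_0[OF W(1)] by blast
      then obtain y where "w = P *v y" using W(2) by (auto simp flip: matrix_vector_mul_assoc)
      with \<open>w \<in> W\<close> \<open>w \<noteq> 0\<close> have y: "y \<in> W'" "y \<noteq> 0" by (auto simp: W'_def)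
      obtain c i where c: "c *s y \<in> vecs ?A" "(c *s y) $ i = 1"
        using nonzero_vec_scale[OF y(2)] by metis
      then have "residue_vec (c *s y) \<in> W0"
        unfolding W0_def using vec.subspace_scale[OF W' y(1)] by blast
      moreover have "residue_vec (c *s y) $ i = 1" using c(2) by (simp add: residue_vec_def)
      then have "residue_vec (c *s y) \<noteq> 0" by (metis zero_index zero_neq_one)
      ultimately show ?thesis by blast
    qed
    ultimately have W0: "W0 = range ((*v) p)" using p(3) unfolding irreducible_rep_def by blast
    have "\<exists>w. w \<in> W' \<and> w \<in> vecs ?A \<and> residue_vec w = p *v axis j 1" for j
    proof -
      have "p *v axis j 1 \<in> W0" unfolding W0 by blast
      then show ?thesis unfolding W0_def by auto
    qed
    then obtain w where w: "\<And>j. w j \<in> W'" "\<And>j. w j \<in> vecs ?A" "\<And>j. residue_vec (w j) = p *v axis j 1"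
      by metis
    define M where "M = column_matrix w"
    have Mj: "M $ i $ j = w j $ i" for i j by (simp add: M_def column_matrix_def)
    have MW': "M *v y \<in> W'" for y
      unfolding M_def column_matrix_vec
      by (intro vec.subspace_sum[OF W'] vec.subspace_scale[OF W'] w(1))
    have eM: "?e ** M = M"
      using eW[OF MW'] by (simp add: matrix_eq flip: matrix_vector_mul_assoc)
    define N where "N = mat 1 + (M - ?e)"
    have eN: "?e ** N = M"
    proof -
      have "?e ** (M - ?e) = ?e ** M - ?e ** ?e"
        by (simp add: vec_eq_iff matrix_matrix_mult_def algebra_simps sum_subtractf)
      then show ?thesis by (simp add: N_def matrix_add_ldistrib eM ee)
    qed
    have N: "N \<in> mats ?A"
      using w(2)
      by (simp add: mats_def vecs_def N_def Mj mat_def const_in_val_ring subring_closed[OF is_subring_val_ring])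
    have resN: "residue_mat N = mat 1"
    proof -
      have "residue (w j $ i) = p $ i $ j" for i j
        using w(3)[of j] by (simp add: vec_eq_iff residue_vec_def matrix_vector_axis)
      moreover have "w j $ i \<in> ?A" for i j using w(2) by (simp add: vecs_def)
      ultimately have "w j $ i - const (p $ i $ j) \<in> max_ideal" for i j
        using residue_diff by metis
      then have "N $ i $ j - const (mat 1 $ i $ j) \<in> max_ideal" for i j
        by (simp add: N_def Mj mat_def)
      then show ?thesis by (simp add: vec_eq_iff residue_unique)
    qed
    have "invertible N"
    proof -
      have "y = 0" if "N *v y = 0" for y
      proof (rule ccontr)
        assume "y \<noteq> 0"
        then obtain c i where c: "c *s y \<in> vecs ?A" "(c *s y) $ i = 1"
          using nonzero_vec_scale by metis
        have "N *v (c *s y) = 0" using that by (simp add: matrix_scalar_mult)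
        then have "residue_vec (c *s y) = residue_vec 0"
          using residue_mat_vec[OF N c(1)] resN by simp
        then have "residue ((c *s y) $ i) = residue 0" by (simp add: residue_vec_def vec_eq_iff)
        then show False unfolding c(2) by simp
      qed
      then show ?thesis unfolding invertible_left_inverse matrix_left_invertible_ker by blast
    qed
    then obtain N' where N': "N ** N' = mat 1" using invertible_obtain by metis
    have "?V \<subseteq> W"
    proof safe
      fix x
      have "(P ** ?e) *v x = P *v (?e *v (N *v (N' *v x)))"
        by (simp add: matrix_cancel(1)[OF N'] flip: matrix_vector_mul_assoc)
      also have "\<dots> = P *v (M *v (N' *v x))" by (simp only: matrix_vector_mul_assoc[of ?e N] eN)
      finally show "(P ** ?e) *v x \<in> W" using MW' by (simp add: W'_def)
    qed
    with W(2) show ?thesis by blast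
  qed
  then show ?thesis using sub inv nonzero unfolding irreducible_rep_def by blast
qed

section \<open>The summands of the free module\<close>

definition frame_summand :: "'k::field ratfun ^ 'n ^ 'n \<Rightarrow> 'k ^ 'n ^ 'n \<Rightarrow> ('k ratfun ^ 'n) set" where
  "frame_summand P p = (*v) (P ** const_mat p) ` laurent_vecs"

lemma const_mat_laurent_vecs: "y \<in> laurent_vecs \<Longrightarrow> const_mat h *v y \<in> laurent_vecs"
  unfolding laurent_vecs_eq
  by (rule matrix_vector_in_vecs[OF is_subring_laurent]) (simp_all add: mats_def const_def)

lemma laurent_submodule_frame_summand:
  assumes P: "laurent_frame P"
  shows "laurent_submodule (frame_summand P p)"
proof -
  have "frame_summand P p \<subseteq> laurent_vecs"
    using P const_mat_laurent_vecs unfolding frame_summand_def laurent_frame_def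
    by (auto simp flip: matrix_vector_mul_assoc)
  moreover have "0 \<in> frame_summand P p"
    unfolding frame_summand_def by (intro image_eqI[of _ _ 0]) (simp_all add: laurent_vecs_def)
  moreover have "v + w \<in> frame_summand P p" if vw: "v \<in> frame_summand P p" "w \<in> frame_summand P p" for v w
  proof -
    obtain x y where "x \<in> laurent_vecs" "y \<in> laurent_vecs"
      "v = (P ** const_mat p) *v x" "w = (P ** const_mat p) *v y"
      using vw unfolding frame_summand_def by blast
    then have "v + w = (P ** const_mat p) *v (x + y)" "x + y \<in> laurent_vecs"
      by (simp_all add: matrix_vector_right_distrib laurent_vecs_def laurent_add)
    then show ?thesis unfolding frame_summand_def by blast
  qed
  moreover have "c *s v \<in> frame_summand P p" if cv: "c \<in> laurent" "v \<in> frame_summand P p" for c v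
  proof -
    obtain x where "x \<in> laurent_vecs" "v = (P ** const_mat p) *v x"
      using cv(2) unfolding frame_summand_def by blast
    then have "c *s v = (P ** const_mat p) *v (c *s x)" "c *s x \<in> laurent_vecs"
      using cv(1) by (simp_all add: matrix_scalar_mult laurent_vecs_def laurent_mult)
    then show ?thesis unfolding frame_summand_def by blast
  qed
  ultimately show ?thesis by (simp add: laurent_submodule_def)
qed

lemma extend_scalars_frame_summand:
  "extend_scalars (frame_summand P p) = range ((*v) (P ** const_mat p))"
proof
  let ?X = "P ** const_mat p"
  have "vec.subspace (range ((*v) ?X))" by (intro vec.subspace_image vec.subspace_UNIV)
  then show "extend_scalars (frame_summand P p) \<subseteq> range ((*v) ?X)"
    unfolding extend_scalars_def by (intro vec.span_minimal) (auto simp: frame_summand_def)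
  show "range ((*v) ?X) \<subseteq> extend_scalars (frame_summand P p)"
  proof safe
    fix y
    have "?X *v axis i 1 \<in> frame_summand P p" for i
      unfolding frame_summand_def laurent_vecs_eq using axis_in_vecs[OF is_subring_laurent] by blast
    then have "(\<Sum>i\<in>UNIV. y $ i *s (?X *v axis i 1)) \<in> extend_scalars (frame_summand P p)"
      unfolding extend_scalars_def by (intro vec.span_sum vec.span_scale vec.span_base)
    moreover have "(\<Sum>i\<in>UNIV. y $ i *s (?X *v axis i 1)) = ?X *v y"
      by (simp add: vec_eq_iff matrix_vector_axis) (simp add: matrix_vector_mult_def mult.commute)
    ultimately show "?X *v y \<in> extend_scalars (frame_summand P p)" by simp
  qed
qed

lemma invariant_frame_summand:
  assumes const: "\<And>g. g \<in> \<Gamma> \<Longrightarrow> \<exists>h. g ** P = P ** const_mat h"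
    and p: "\<And>h. h \<in> constant_action \<Gamma> P \<Longrightarrow> p ** h = h ** p"
  shows "invariant \<Gamma> (frame_summand P p)"
  unfolding invariant_def
proof (intro ballI)
  fix g v assume g: "g \<in> \<Gamma>" and "v \<in> frame_summand P p"
  then obtain y where y: "v = (P ** const_mat p) *v y" "y \<in> laurent_vecs"
    unfolding frame_summand_def by blast
  obtain h where h: "g ** P = P ** const_mat h" using const[OF g] by blast
  then have "p ** h = h ** p" using p g unfolding constant_action_def by blast
  then have "const_mat h ** const_mat p = const_mat p ** const_mat h" by (metis const_mat_mult)
  then have "g *v v = (P ** const_mat p) *v (const_mat h *v y)"
    unfolding y(1) by (metis h matrix_mul_assoc matrix_vector_mul_assoc)
  then show "g *v v \<in> frame_summand P p"
    unfolding frame_summand_def using const_mat_laurent_vecs[OF y(2)] by blast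
qed

text \<open>Matrices over \<open>k\<close> preserve \<open>R\<^sup>n\<close>, so orthogonal idempotents over \<open>k\<close> with sum 1 are the projections
  of a decomposition of \<open>R\<^sup>n\<close>, which \<open>P\<close> carries to another one.\<close>

lemma direct_sum_frame_summands:
  fixes e :: "'i \<Rightarrow> 'k::field ^ 'n ^ 'n"
  assumes P: "laurent_frame P" and I: "finite I"
    and e: "(\<Sum>i\<in>I. e i) = mat 1" "\<And>i. i \<in> I \<Longrightarrow> e i ** e i = e i"
      "\<And>i j. i \<in> I \<Longrightarrow> j \<in> I \<Longrightarrow> i \<noteq> j \<Longrightarrow> e i ** e j = 0"
  shows "direct_sum_decomp I (\<lambda>i. frame_summand P (e i)) laurent_vecs"
  unfolding direct_sum_decomp_def
proof (intro conjI allI impI)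
  let ?M = "\<lambda>i. frame_summand P (e i)"
  show "laurent_vecs = {\<Sum>i\<in>I. m i |m. \<forall>i\<in>I. m i \<in> ?M i}"
  proof (intro equalityI subsetI)
    fix v :: "'k ratfun ^ 'n" assume "v \<in> laurent_vecs"
    then obtain y where y: "y \<in> laurent_vecs" "v = P *v y"
      using P unfolding laurent_frame_def by blast
    have "(\<Sum>i\<in>I. (P ** const_mat (e i)) *v y) = (\<Sum>i\<in>I. P ** const_mat (e i)) *v y"
      using I by (induction I) (simp_all add: matrix_vector_mult_add_rdistrib)
    also have "(\<Sum>i\<in>I. P ** const_mat (e i)) = P"
      by (simp add: const_mat_1 e(1) flip: matrix_sum_mult_right const_mat_sum)
    finally have "v = (\<Sum>i\<in>I. (P ** const_mat (e i)) *v y)" using y(2) by simp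
    moreover have "\<forall>i\<in>I. (P ** const_mat (e i)) *v y \<in> ?M i"
      using y(1) by (auto simp: frame_summand_def)
    ultimately show "v \<in> {\<Sum>i\<in>I. m i |m. \<forall>i\<in>I. m i \<in> ?M i}"
      by (intro CollectI exI[of _ "\<lambda>i. (P ** const_mat (e i)) *v y"] conjI)
  next
    fix v assume "v \<in> {\<Sum>i\<in>I. m i |m. \<forall>i\<in>I. m i \<in> ?M i}"
    then obtain m where m: "v = (\<Sum>i\<in>I. m i)" "\<And>i. i \<in> I \<Longrightarrow> m i \<in> ?M i" by blast
    have "m i $ j \<in> laurent" if "i \<in> I" for i j
      using m(2)[OF that] laurent_submodule_frame_summand[OF P]
      unfolding laurent_submodule_def laurent_vecs_def by blast
    then show "v \<in> laurent_vecs" by (simp add: m(1) laurent_vecs_def laurent_sum)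
  qed
next
  fix m assume m: "(\<forall>i\<in>I. m i \<in> frame_summand P (e i)) \<and> (\<Sum>i\<in>I. m i) = 0"
  obtain P' where P': "P' ** P = mat 1"
    using P invertible_obtain unfolding laurent_frame_def by metis
  have "\<forall>i\<in>I. \<exists>y. m i = (P ** const_mat (e i)) *v y"
    using m unfolding frame_summand_def by blast
  then obtain y where y: "\<And>i. i \<in> I \<Longrightarrow> m i = (P ** const_mat (e i)) *v y i" by metis
  \<comment> \<open>The coordinate change \<open>P'\<close> followed by \<open>e i\<close> picks out the component with index \<open>i\<close>.\<close>
  have proj: "(const_mat (e i) ** P') *v m j = (if i = j then const_mat (e i) *v y i else 0)"
    if "i \<in> I" "j \<in> I" for i j
  proof -
    have "(const_mat (e i) ** P') *v m j = const_mat (e i ** e j) *v y j"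
      by (simp add: y[OF that(2)] const_mat_mult matrix_cancel(1)[OF P'] flip: matrix_vector_mul_assoc)
    moreover have "const_mat (0 :: 'k ^ 'n ^ 'n) = 0" by (simp add: vec_eq_iff)
    ultimately show ?thesis using e(2)[OF that(1)] e(3)[OF that] by auto
  qed
  show "\<forall>i\<in>I. m i = 0"
  proof
    fix i assume i: "i \<in> I"
    have "0 = (const_mat (e i) ** P') *v (\<Sum>j\<in>I. m j)" using m by simp
    also have "\<dots> = (\<Sum>j\<in>I. (const_mat (e i) ** P') *v m j)" by (rule vec.sum)
    also have "\<dots> = (\<Sum>j\<in>I. if i = j then const_mat (e i) *v y i else 0)"
      by (rule sum.cong) (simp_all add: proj i)
    also have "\<dots> = const_mat (e i) *v y i" using I i by simp
    finally have "const_mat (e i) *v y i = 0" by simp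
    then show "m i = 0" using y[OF i] by (simp flip: matrix_vector_mul_assoc)
  qed
qed

theorem proposition37:
  fixes \<Gamma> :: "('k::field ratfun ^ 'n::finite ^ 'n) set"
  assumes "CARD('n) \<ge> 2"
    and "subgroup \<Gamma> SL_laurent"
    and "completely_reducible \<Gamma>"
  shows "\<exists>r\<ge>1. \<exists>M :: nat \<Rightarrow> ('k ratfun ^ 'n) set.
    direct_sum_decomp {1..r} M laurent_vecs \<and>
    (\<forall>i\<in>{1..r}. laurent_submodule (M i) \<and> invariant \<Gamma> (M i) \<and>
       irreducible_rep \<Gamma> (extend_scalars (M i)))"
proof -
  note \<Gamma> = assms(2) and cr = assms(3)
  obtain \<sigma> where \<sigma>: "\<sigma> \<in> fixed_simplices \<Gamma> Pos"
    using cr unfolding completely_reducible_def by blast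
  obtain f where f: "free_basis laurent f laurent_vecs"
    "\<And>v L. v \<in> \<sigma> \<Longrightarrow> L \<in> v \<Longrightarrow> \<exists>a. L = lattice_of Pos (column_matrix f ** tvar_diag a) \<and>
      (\<forall>g\<in>\<Gamma>. \<forall>\<epsilon>. (*v) g ` lattice_of \<epsilon> (column_matrix f ** tvar_diag a) =
        lattice_of \<epsilon> (column_matrix f ** tvar_diag a))"
    by (rule fixed_simplex_common_frame[OF \<Gamma> cr \<sigma>]) (rule that)
  have "\<sigma> \<in> simplices Pos" using \<sigma> by (simp add: fixed_simplices_def)
  then obtain L0 where "hclass L0 \<in> \<sigma>" unfolding simplices_def by blast
  from f(2)[OF this hclass_self] obtain a where a: "\<And>g \<epsilon>. g \<in> \<Gamma> \<Longrightarrow>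
      (*v) g ` lattice_of \<epsilon> (column_matrix f ** tvar_diag a) = lattice_of \<epsilon> (column_matrix f ** tvar_diag a)"
    by blast
  define P where "P = column_matrix f ** tvar_diag a"
  have P: "laurent_frame P"
    unfolding P_def by (intro laurent_frame_mult laurent_frame_column_matrix laurent_frame_tvar_diag f(1))
  then have invP: "invertible P" by (simp add: laurent_frame_def)
  have const: "\<exists>h. g ** P = P ** const_mat h" if "g \<in> \<Gamma>" for g
    using frame_action_const[OF P SL_laurent_subgroupD(1)[OF \<Gamma> that]] a[OF that] unfolding P_def by metis
  let ?\<Delta> = "constant_action \<Gamma> P"
  have complements: "\<exists>p. p ** p = p \<and> range ((*v) p) = U \<and> (\<forall>h\<in>?\<Delta>. p ** h = h ** p)"
    if U: "vec.subspace U" "invariant ?\<Delta> U" for U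
  proof -
    consider "U = {0}" | "U = UNIV" | "U \<noteq> {0}" "U \<noteq> UNIV" by blast
    then show ?thesis
    proof cases
      case 1
      then show ?thesis by (intro exI[of _ 0]) auto
    next
      case 2
      then show ?thesis by (intro exI[of _ "mat 1"]) auto
    next
      case 3
      then show ?thesis using invariant_subspace_projection[OF \<Gamma> cr invP const U] by metis
    qed
  qed
  have "\<exists>S. finite S \<and> mat 1 = \<Sum>S \<and>
      (\<forall>p\<in>S. p ** p = p \<and> (\<forall>h\<in>?\<Delta>. p ** h = h ** p) \<and> irreducible_rep ?\<Delta> (range ((*v) p))) \<and>
      (\<forall>p\<in>S. \<forall>q\<in>S. p \<noteq> q \<longrightarrow> p ** q = 0)"
    by (rule irreducible_idempotents[OF complements]) simp_all
  then obtain S where S: "finite S" "mat 1 = \<Sum>S"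
      "\<And>p. p \<in> S \<Longrightarrow> p ** p = p \<and> (\<forall>h\<in>?\<Delta>. p ** h = h ** p) \<and> irreducible_rep ?\<Delta> (range ((*v) p))"
      "\<And>p q. p \<in> S \<Longrightarrow> q \<in> S \<Longrightarrow> p \<noteq> q \<Longrightarrow> p ** q = 0"
    by (elim exE conjE) (rule that, assumption, assumption, blast+)
  obtain e where e: "bij_betw e {1..card S} S" using ex_bij_betw_nat_finite_1[OF S(1)] by blast
  then have eS: "\<And>i. i \<in> {1..card S} \<Longrightarrow> e i \<in> S" and inj: "inj_on e {1..card S}"
    by (auto simp: bij_betw_def)
  have "S \<noteq> {}"
  proof
    assume "S = {}"
    then have "mat 1 = (0 :: 'k ^ 'n ^ 'n)" using S(2) by simp
    then have "mat 1 $ i $ i = (0 :: 'k ^ 'n ^ 'n) $ i $ i" for i by simp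
    then show False by (simp add: mat_def)
  qed
  then have "1 \<le> card S" using S(1) by (simp add: Suc_le_eq card_gt_0_iff)
  moreover have "direct_sum_decomp {1..card S} (\<lambda>i. frame_summand P (e i)) laurent_vecs"
  proof (rule direct_sum_frame_summands[OF P])
    show "(\<Sum>i\<in>{1..card S}. e i) = mat 1"
      using sum.reindex_bij_betw[OF e, of "\<lambda>p. p"] S(2) by simp
    fix i j assume ij: "i \<in> {1..card S}" "j \<in> {1..card S}"
    show "e i ** e i = e i" using S(3)[OF eS[OF ij(1)]] by blast
    assume "i \<noteq> j"
    then have "e i \<noteq> e j" using inj_onD[OF inj _ ij] by blast
    then show "e i ** e j = 0" by (rule S(4)[OF eS[OF ij(1)] eS[OF ij(2)]])
  qed simp
  moreover have "laurent_submodule (frame_summand P (e i)) \<and> invariant \<Gamma> (frame_summand P (e i)) \<and>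
       irreducible_rep \<Gamma> (extend_scalars (frame_summand P (e i)))" if "i \<in> {1..card S}" for i
    using S(3)[OF eS[OF that]] unfolding extend_scalars_frame_summand
    by (intro conjI laurent_submodule_frame_summand[OF P] invariant_frame_summand const
        irreducible_after_scalar_extension[OF invP]) auto
  ultimately show ?thesis by (intro exI[of _ "card S"] exI[of _ "\<lambda>i. frame_summand P (e i)"]) blast
qed

end
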